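(* Let $A$ be any set (equipped with a $\sigma$-algebra of measurable sets) and let $\Omega=A^{\mathbb{Z}}$. Let $\mathbb{P}$ be a stationary probability measure on $\Omega$ such that $(\Omega,\mathbb{P})$ satisfies Berbee's ratio condition. Then $(\Omega,\mathbb{P})$ is a random-step Markov process.
   Context: Notation: $\mathbb{Z}^+=\{1,2,\dots\}$, $\mathbb{Z}^-=\{-1,-2,\dots\}$; $\Omega$ carries the product $\sigma$-algebra and $X_i$ denotes the $i$-th coordinate, so that $((X_i)_{i\in\mathbb{Z}},\mathbb{P})$ is a stationary process on $A$. $(X_i)_{i=-n}^{-1}=(\omega_i)_{i=-n}^{-1}$ abbreviates $X_{-1}=\omega_{-1},\dots,X_{-n}=\omega_{-n}$, and similarly for infinite pasts $(X_i)_{i<0}=(\omega_i)_{i<0}$. Conditional laws $\mathbb{P}(X_0\in\cdot\mid\cdots)$ are treated as probability measures on $A$ (regular conditional distributions). Since conditional probabilities are only defined up to null sets, all conditions below quantified over $\omega$ need only hold for almost every $\omega$. Berbee's ratio condition: for every $\varepsilon>0$ there exists $n=n(\varepsilon)$ such that for every $(\omega_i)_{i<0}\in A^{\mathbb{Z}^-}$ and every measurable set $E_0\subseteq A$, $$\left|\frac{\mathbb{P}(X_0\in E_0\mid (X_i)_{i<0}=(\omega_i)_{i<0})}{\mathbb{P}(X_0\in E_0\mid (X_i)_{i=-n}^{-1}=(\omega_i)_{i=-n}^{-1})}-1\right|<\varepsilon,$$ with the convention $\frac{0}{0}=1$ (a $0$ appears in the denominator only when the numerator is also $0$). Random-step Markov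 process (random Markov process): a stationary process $((X_i)_{i\in\mathbb{Z}},\mathbb{P})$ on $A$ for which there exist an independent stationary process $(L_i)_{i\in\mathbb{Z}}$ with values in $\mathbb{Z}^+$ (the $L_i$ are independent and identically distributed) and a stationary coupling $\hat{\mathbb{P}}$ of $(X_i)_{i\in\mathbb{Z}}$ and $(L_i)_{i\in\mathbb{Z}}$ such that $L_0$ is independent of $\{X_i:i<0\}$ and, for every $n\in\mathbb{Z}^+$, $\omega\in A^{\mathbb{Z}}$ and measurable set $E_0\subseteq A$, $$\hat{\mathbb{P}}\big(X_0\in E_0\mid (X_i)_{i=-n}^{-1}=(\omega_i)_{i=-n}^{-1}\wedge L_0=n\big)=\hat{\mathbb{P}}\big(X_0\in E_0\mid (X_i)_{i<0}=(\omega_i)_{i<0}\wedge L_0=n\big).$$ *)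

theory Defs
  imports "HOL-Probability.Probability"
begin

text \<open>The alphabet is the measurable space \<open>A\<close>; a process on \<open>A\<close> is identified with its law
  on the product space \<open>seq_space A\<close>, whose coordinates are the random variables \<open>X_i\<close>.\<close>

definition seq_space :: "'a measure \<Rightarrow> (int \<Rightarrow> 'a) measure" where
  "seq_space A = Pi\<^sub>M UNIV (\<lambda>_. A)"

definition stationary_process :: "'a measure \<Rightarrow> (int \<Rightarrow> 'a) measure \<Rightarrow> bool" where
  "stationary_process A P \<longleftrightarrow>
     prob_space P \<and> sets P = sets (seq_space A) \<and>
     distr P (seq_space A) (\<lambda>\<omega> i. \<omega> (i + 1)) = P"

text \<open>\<open>\<kappa>\<close> is a regular version of the conditional law of \<open>X\<close> given \<open>Y = y\<close>. No
  standard-Borel assumption is made on \<open>A\<close>, so such a \<open>\<kappa>\<close> need not exist; two versions may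
  moreover differ, as measures, on a set of values \<open>y\<close> that is not null.\<close>

definition regular_cond_dist ::
  "'w measure \<Rightarrow> 'a measure \<Rightarrow> ('w \<Rightarrow> 'a) \<Rightarrow> 'b measure \<Rightarrow> ('w \<Rightarrow> 'b) \<Rightarrow> ('b \<Rightarrow> 'a measure) \<Rightarrow> bool"
where
  "regular_cond_dist P A X B Y \<kappa> \<longleftrightarrow>
     \<kappa> \<in> B \<rightarrow>\<^sub>M prob_algebra A \<and>
     (\<forall>E\<in>sets A. AE w in P. measure (\<kappa> (Y w)) E =
        real_cond_exp P (vimage_algebra (space P) Y B)
          (indicat_real {w \<in> space P. X w \<in> E}) w)"

text \<open>The index sets of the infinite past and of the past of length \<open>n\<close>.\<close>

abbreviation (input) past :: "int set" where
  "past \<equiv> {..<0}"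

abbreviation (input) past_upto :: "nat \<Rightarrow> int set" where
  "past_upto n \<equiv> {- int n..<0}"

text \<open>The ratio of conditional probabilities, with \<open>0 / 0 = 1\<close>. The case of a zero
  denominator and a nonzero numerator is excluded separately in the ratio condition, since
  \<open>p / 0 = 0\<close> in HOL.\<close>

definition prob_ratio :: "real \<Rightarrow> real \<Rightarrow> real" where
  "prob_ratio p q = (if p = 0 \<and> q = 0 then 1 else p / q)"

definition berbee_ratio_condition :: "'a measure \<Rightarrow> (int \<Rightarrow> 'a) measure \<Rightarrow> bool" where
  "berbee_ratio_condition A P \<longleftrightarrow>
     (\<exists>\<kappa>. regular_cond_dist P A (\<lambda>\<omega>. \<omega> 0) (Pi\<^sub>M past (\<lambda>_. A)) (\<lambda>\<omega>. restrict \<omega> past) \<kappa> \<and>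
       (\<forall>\<epsilon>>0. \<exists>n>0. \<exists>\<kappa>n.
          regular_cond_dist P A (\<lambda>\<omega>. \<omega> 0)
            (Pi\<^sub>M (past_upto n) (\<lambda>_. A)) (\<lambda>\<omega>. restrict \<omega> (past_upto n)) \<kappa>n \<and>
          (AE \<omega> in P. \<forall>E\<in>sets A.
             (let p = measure (\<kappa> (restrict \<omega> past)) E;
                  q = measure (\<kappa>n (restrict \<omega> (past_upto n))) E
              in (q = 0 \<longrightarrow> p = 0) \<and> \<bar>prob_ratio p q - 1\<bar> < \<epsilon>))))"

definition pos_nat_space :: "nat measure" where
  "pos_nat_space = count_space {1..}"

text \<open>In the coupling \<open>Q\<close>, the \<open>i\<close>-th coordinate is the pair \<open>(X_i, L_i)\<close>. That the \<open>L_i\<close> are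
  identically distributed is part of the stationarity of their law \<open>R\<close>. The independence of
  \<open>L_0\<close> and the past is stated for the generated \<open>\<sigma>\<close>-algebras because \<open>indep_var\<close> requires
  random variables of equal type. Conditioning on the event \<open>L_0 = n\<close> is expressed by passing
  to the measure \<open>Qn\<close>, and is meaningful only if that event has positive probability.\<close>

definition random_step_markov :: "'a measure \<Rightarrow> (int \<Rightarrow> 'a) measure \<Rightarrow> bool" where
  "random_step_markov A P \<longleftrightarrow>
     stationary_process A P \<and>
     (\<exists>(R :: (int \<Rightarrow> nat) measure) (Q :: (int \<Rightarrow> 'a \<times> nat) measure).
        stationary_process pos_nat_space R \<and>
        prob_space.indep_vars R (\<lambda>_. pos_nat_space) (\<lambda>i l. l i) UNIV \<and>
        stationary_process (A \<Otimes>\<^sub>M pos_nat_space) Q \<and>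
        distr Q (seq_space A) (\<lambda>w i. fst (w i)) = P \<and>
        distr Q (seq_space pos_nat_space) (\<lambda>w i. snd (w i)) = R \<and>
        prob_space.indep_set Q
          (sets (vimage_algebra (space Q) (\<lambda>w. snd (w 0)) pos_nat_space))
          (sets (vimage_algebra (space Q) (\<lambda>w. \<lambda>i\<in>past. fst (w i)) (Pi\<^sub>M past (\<lambda>_. A)))) \<and>
        (\<forall>n>0. measure Q {w \<in> space Q. snd (w 0) = n} > 0 \<longrightarrow>
           (let Qn = uniform_measure Q {w \<in> space Q. snd (w 0) = n} in
            \<exists>\<kappa>n \<kappa>.
              regular_cond_dist Qn A (\<lambda>w. fst (w 0))
                (Pi\<^sub>M (past_upto n) (\<lambda>_. A)) (\<lambda>w. \<lambda>i\<in>past_upto n. fst (w i)) \<kappa>n \<and>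
              regular_cond_dist Qn A (\<lambda>w. fst (w 0))
                (Pi\<^sub>M past (\<lambda>_. A)) (\<lambda>w. \<lambda>i\<in>past. fst (w i)) \<kappa> \<and>
              (AE w in Qn. \<forall>E\<in>sets A.
                 measure (\<kappa>n (\<lambda>i\<in>past_upto n. fst (w i))) E =
                 measure (\<kappa> (\<lambda>i\<in>past. fst (w i))) E))))"

end

theory Submission imports Defs begin

text \<open>Write \<open>\<kappa>\<close> for the law of \<open>X_0\<close> given the past. The ratio condition gives kernels \<open>q_k\<close> that
  depend on finite pasts and approximate \<open>\<kappa>\<close> up to a factor \<open>1 \<plusminus> 1 / (2 (k + 1)\<^sup>2)\<close>. With
  \<open>c_k = k / (k + 1)\<close> the measures \<open>c_k q_k\<close> increase to \<open>\<kappa>\<close>, so their increments, normalised by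
  \<open>p_k = c_(k+1) - c_k\<close>, are finite-past kernels \<open>\<mu>_k\<close> with \<open>\<kappa> = \<Sum>k. p_k \<mu>_k\<close>. Let \<open>g_k\<close> be the density
  of \<open>p_k \<mu>_k\<close> with respect to \<open>\<kappa>\<close>, as a function of the past and \<open>X_0\<close>. Given the whole sequence
  \<open>X\<close>, choose the steps \<open>L_i\<close> independently, with \<open>L_i = m_k\<close> (the length of the past used by \<open>\<mu>_k\<close>)
  with probability \<open>g_k\<close> evaluated at time \<open>i\<close>. Since \<open>g_k\<close> has conditional mean \<open>p_k\<close> given the past,
  \<open>L_i\<close> is independent of the past and the \<open>L_i\<close> are i.i.d.; given \<open>L_0 = m_k\<close>, the
  law of \<open>X_0\<close> given the past is \<open>\<mu>_k\<close>.\<close>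

subsection \<open>Densities of dominated kernels\<close>

text \<open>The constants are tied together. With errors \<open>e_k\<close>, the comparison
  \<open>c_k q_k \<le> c_(k+1) q_(k+1)\<close> follows from
  \<open>c_k (1 + e_(k+1)) \<le> c_(k+1) (1 - e_k)\<close>. The weights k / (k + 1) have gaps 1 /
  ((k + 1) (k + 2)), so errors of order 1 / k^2 are affordable. The value \<open>c_0 = 0\<close>
  lets the telescoping start from the zero measure, and \<open>c_k\<close> tending to 1 exhausts
  \<kappa>.

  The obstacle is that the alphabet carries no standard Borel structure. Densities chosen separately
  at each past need not be jointly measurable, and identities between kernels are available only for
  one set at a time, off a null set depending on it. Radon-Nikodym is therefore applied to joint
  laws on the product of past and alphabet. Domination, in contrast, is carried along for all sets
  at once, because the sections of a measurable set in the product vary with the past.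

  Attaching the steps to a given sequence X keeps its law equal to the given one by construction, so
  that only the joint behaviour of the steps and X has to be computed.\<close>

lemma nn_integral_kernel_bind:
  assumes Y[measurable]: "Y \<in> P \<rightarrow>\<^sub>M B" and K[measurable]: "K \<in> B \<rightarrow>\<^sub>M subprob_algebra A"
    and f[measurable]: "f \<in> borel_measurable (B \<Otimes>\<^sub>M A)"
  shows "(\<integral>\<^sup>+z. f z \<partial>(P \<bind> (\<lambda>w. distr (K (Y w)) (B \<Otimes>\<^sub>M A) (Pair (Y w))))) =
    (\<integral>\<^sup>+w. \<integral>\<^sup>+x. f (Y w, x) \<partial>K (Y w) \<partial>P)"
proof -
  have *: "(\<lambda>w. distr (K (Y w)) (B \<Otimes>\<^sub>M A) (Pair (Y w))) \<in> P \<rightarrow>\<^sub>M subprob_algebra (B \<Otimes>\<^sub>M A)"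
    by (rule measurable_distr2[where M = A]) measurable
  have "sets (K (Y w)) = sets A" if "w \<in> space P" for w
    using that by (meson K Y measurable_space sets_kernel)
  then have "Pair (Y w) \<in> K (Y w) \<rightarrow>\<^sub>M B \<Otimes>\<^sub>M A" if "w \<in> space P" for w
    using that measurable_space[OF Y that] by (simp cong: measurable_cong_sets)
  then show ?thesis
    by (subst nn_integral_bind[OF f *]) (auto intro!: nn_integral_cong simp: nn_integral_distr)
qed

text \<open>Testing on the set \<open>D\<close> where \<open>f\<close> exceeds 1 is enough.
  \<open>M\<close> is finite, so the excess over \<open>D\<close> may be integrated as a difference,
  and domination makes that difference vanish in the truncated arithmetic of
  \<open>ennreal\<close>.\<close>

lemma AE_density_le_1:
  assumes "finite_measure M" and f[measurable]: "f \<in> borel_measurable M"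
    and le: "\<And>D. D \<in> sets M \<Longrightarrow> emeasure (density M f) D \<le> emeasure M D"
  shows "AE x in M. f x \<le> (1::ennreal)"
proof -
  interpret finite_measure M by fact
  define D where "D = {x \<in> space M. 1 < f x}"
  have D[measurable]: "D \<in> sets M" unfolding D_def by measurable
  have "(\<integral>\<^sup>+x. f x * indicator D x - indicator D x \<partial>M) =
     (\<integral>\<^sup>+x. f x * indicator D x \<partial>M) - (\<integral>\<^sup>+x. indicator D x \<partial>M)"
  proof (rule nn_integral_diff)
    show "(\<integral>\<^sup>+x. indicator D x \<partial>M) \<noteq> \<infinity>"
      using nn_integral_indicator[OF D] by simp
  qed (auto simp: D_def indicator_def intro: less_imp_le)
  also have "\<dots> = 0"
    using le[OF D] emeasure_finite[of D]
    by (auto simp: emeasure_density less_top[symmetric] intro!: diff_eq_0_ennreal)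
      (metis emeasure_finite infinity_ennreal_def top.extremum_uniqueI)
  finally have "AE x in M. f x * indicator D x - indicator D x = 0"
    by (subst (asm) nn_integral_0_iff_AE) auto
  then show ?thesis
    using AE_space
  proof eventually_elim
    case (elim x)
    show ?case
    proof (rule ccontr)
      assume "\<not> f x \<le> 1"
      with elim(2) have "x \<in> D" by (simp add: D_def)
      with elim(1) have "f x - 1 = 0" by simp
      with \<open>\<not> f x \<le> 1\<close> show False by (simp add: ennreal_minus_eq_0)
    qed
  qed
qed

text \<open>Both functions are densities of the same measure with respect to the law of
  \<open>Y\<close>, and densities of finite mass are unique. Events of \<open>Y\<close> suffice as
  tests because both sides factor through \<open>Y\<close>.\<close>

lemma AE_eq_if_nn_integral_eq:
  assumes "prob_space P" and Y[measurable]: "Y \<in> P \<rightarrow>\<^sub>M B"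
    and u[measurable]: "u \<in> borel_measurable B" and v[measurable]: "v \<in> borel_measurable B"
    and fin: "(\<integral>\<^sup>+w. u (Y w) \<partial>P) \<noteq> \<infinity>"
    and eq: "\<And>C. C \<in> sets B \<Longrightarrow>
      (\<integral>\<^sup>+w. u (Y w) * indicator C (Y w) \<partial>P) = (\<integral>\<^sup>+w. v (Y w) * indicator C (Y w) \<partial>P)"
  shows "AE w in P. u (Y w) = v (Y w)"
proof -
  have "density (distr P B Y) u = density (distr P B Y) v"
    by (rule measure_eqI) (simp_all add: emeasure_density nn_integral_distr eq)
  then have "AE y in distr P B Y. u y = v y"
    using fin by (subst (asm) finite_density_unique) (auto simp: nn_integral_distr)
  then show ?thesis
    by (subst (asm) AE_distr_iff) auto
qed

text \<open>The Radon-Nikodym derivative is taken between the two joint laws on the product rather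
  than between \<open>K1 y\<close> and \<open>K2 y\<close> for each \<open>y\<close>; this makes
  \<open>h\<close> measurable in both arguments. The price is that the identity holds off a null set
  depending on \<open>E\<close>.\<close>

lemma density_of_dominated_kernel:
  fixes c1 c2 :: real
  assumes P: "prob_space P" and Y[measurable]: "Y \<in> P \<rightarrow>\<^sub>M B"
    and K1[measurable]: "K1 \<in> B \<rightarrow>\<^sub>M subprob_algebra A"
    and K2[measurable]: "K2 \<in> B \<rightarrow>\<^sub>M subprob_algebra A"
    and dom: "AE w in P. \<forall>E\<in>sets A.
      ennreal c1 * emeasure (K1 (Y w)) E \<le> ennreal c2 * emeasure (K2 (Y w)) E"
  obtains h where "h \<in> borel_measurable (B \<Otimes>\<^sub>M A)" "\<forall>z. h z \<le> (1::ennreal)"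
    "\<forall>E\<in>sets A. AE w in P. ennreal c1 * emeasure (K1 (Y w)) E =
        ennreal c2 * (\<integral>\<^sup>+x. h (Y w, x) * indicator E x \<partial>K2 (Y w))"
proof -
  interpret prob_space P by fact
  \<comment> \<open>\<open>J K\<close> is the joint law of \<open>Y\<close> and a point drawn from
    \<open>K\<close> at \<open>Y\<close>. It is formed over \<open>P\<close> itself, so that almost
    sure hypotheses on \<open>w\<close> can be used under the outer integral.\<close>
  define J where "J K = P \<bind> (\<lambda>w. distr (K (Y w)) (B \<Otimes>\<^sub>M A) (Pair (Y w)))" for K
  have sJ: "sets (J K) = sets (B \<Otimes>\<^sub>M A)" for K
    unfolding J_def using not_empty by (intro sets_bind) auto
  have J: "(\<integral>\<^sup>+z. f z \<partial>J K) = (\<integral>\<^sup>+w. \<integral>\<^sup>+x. f (Y w, x) \<partial>K (Y w) \<partial>P)"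
    if "K \<in> B \<rightarrow>\<^sub>M subprob_algebra A" "f \<in> borel_measurable (B \<Otimes>\<^sub>M A)" for K f
    unfolding J_def by (rule nn_integral_kernel_bind) (use that in measurable)
  have sK: "sets (K (Y w)) = sets A"
    if "K \<in> B \<rightarrow>\<^sub>M subprob_algebra A" "w \<in> space P" for K w
    using that by (meson Y measurable_space sets_kernel)
  have sub: "emeasure (K (Y w)) D \<le> 1" 
    if "K \<in> B \<rightarrow>\<^sub>M subprob_algebra A" "w \<in> space P" for K w D
    using subprob_space.subprob_emeasure_le_1[of "K (Y w)" D] that
    by (meson Y measurable_space subprob_space_kernel)
  define N1 where "N1 = scale_measure (ennreal c1) (J K1)"
  define N2 where "N2 = scale_measure (ennreal c2) (J K2)"
  have sN[measurable_cong]: "sets N1 = sets (B \<Otimes>\<^sub>M A)" "sets N2 = sets (B \<Otimes>\<^sub>M A)"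
    by (simp_all add: N1_def N2_def sJ)
  have slice: "emeasure (K (Y w)) (Pair (Y w) -` D) = (\<integral>\<^sup>+x. indicator D (Y w, x) \<partial>K (Y w))"
    if "K \<in> B \<rightarrow>\<^sub>M subprob_algebra A" "D \<in> sets (B \<Otimes>\<^sub>M A)" "w \<in> space P" for K D w
    using nn_integral_indicator[of "Pair (Y w) -` D" "K (Y w)"] sets_Pair1[OF that(2)]
      sK[OF that(1,3)] by (simp only: indicator_vimage)
  have em: "emeasure (J K) D = (\<integral>\<^sup>+w. emeasure (K (Y w)) (Pair (Y w) -` D) \<partial>P)"
    if "K \<in> B \<rightarrow>\<^sub>M subprob_algebra A" "D \<in> sets (B \<Otimes>\<^sub>M A)" for K D
  proof -
    have "emeasure (J K) D = (\<integral>\<^sup>+z. indicator D z \<partial>J K)"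
      using that by (simp add: sJ)
    also have "\<dots> = (\<integral>\<^sup>+w. \<integral>\<^sup>+x. indicator D (Y w, x) \<partial>K (Y w) \<partial>P)"
      using that by (intro J) auto
    also have "\<dots> = (\<integral>\<^sup>+w. emeasure (K (Y w)) (Pair (Y w) -` D) \<partial>P)"
      by (intro nn_integral_cong slice[symmetric] that)
    finally show ?thesis .
  qed
  have meas: "(\<lambda>w. emeasure (K (Y w)) (Pair (Y w) -` D)) \<in> borel_measurable P"
    if [measurable]: "K \<in> B \<rightarrow>\<^sub>M subprob_algebra A" "D \<in> sets (B \<Otimes>\<^sub>M A)" for K D
  proof (subst measurable_cong[OF slice[OF that]])
    show "(\<lambda>w. \<integral>\<^sup>+x. indicator D (Y w, x) \<partial>K (Y w)) \<in> borel_measurable P"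
      by (rule nn_integral_measurable_subprob_algebra2[where N = A]) measurable
  qed
  have le: "emeasure N1 D \<le> emeasure N2 D" if D: "D \<in> sets (B \<Otimes>\<^sub>M A)" for D
  proof -
    \<comment> \<open>The set \<open>E\<close> in \<open>dom\<close> has to depend on
      \<open>w\<close>, since here it is the section of \<open>D\<close> at \<open>Y w\<close>;
      hence the quantifier over \<open>E\<close> inside the almost sure statement.\<close>
    have "AE w in P. ennreal c1 * emeasure (K1 (Y w)) (Pair (Y w) -` D)
        \<le> ennreal c2 * emeasure (K2 (Y w)) (Pair (Y w) -` D)"
      using dom by eventually_elim (use sets_Pair1[OF D] in blast)
    from nn_integral_mono_AE[OF this] show ?thesis
      using D by (simp add: N1_def N2_def em nn_integral_cmult meas)
  qed
  have fin: "finite_measure N2"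
  proof
    have "emeasure (J K2) (space (B \<Otimes>\<^sub>M A)) \<le> (\<integral>\<^sup>+w. 1 \<partial>P)"
      unfolding em[OF K2 sets.top] by (intro nn_integral_mono sub) auto
    then have "emeasure (J K2) (space (B \<Otimes>\<^sub>M A)) \<le> 1"
      by (simp add: emeasure_space_1)
    then show "emeasure N2 (space N2) \<noteq> \<infinity>"
      using sets_eq_imp_space_eq[OF sN(2)]
      by (auto simp: N2_def ennreal_mult_eq_top_iff top_unique)
  qed
  then interpret N2: finite_measure N2 .
  have "absolutely_continuous N2 N1"
    unfolding absolutely_continuous_def null_sets_def using le by (auto simp: sN)
      (metis le_zero_eq)
  then obtain f where f[measurable]: "f \<in> borel_measurable N2" and fd: "density N2 f = N1"
    using N2.Radon_Nikodym sN by metis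
  have "AE z in N2. f z \<le> 1"
    by (rule AE_density_le_1[OF fin f]) (auto simp: fd sN le)
  \<comment> \<open>Truncation at 1 changes \<open>f\<close> only on a null set and gives the bound
    at every point, so that \<open>1 - h\<close> is later a true complement in
    \<open>ennreal\<close>.\<close>
  then have fd': "density N2 (\<lambda>z. min (f z) 1) = N1"
    unfolding fd[symmetric] by (intro density_cong) (auto simp: min_def)
  define h where "h z = min (f z) 1" for z
  have h[measurable]: "h \<in> borel_measurable (B \<Otimes>\<^sub>M A)"
    using f unfolding h_def by measurable
  show thesis
  proof
    show "\<forall>z. h z \<le> 1" by (simp add: h_def)
    show "\<forall>E\<in>sets A. AE w in P. ennreal c1 * emeasure (K1 (Y w)) E =
        ennreal c2 * (\<integral>\<^sup>+x. h (Y w, x) * indicator E x \<partial>K2 (Y w))"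
    proof
      fix E assume E[measurable]: "E \<in> sets A"
      show "AE w in P. ennreal c1 * emeasure (K1 (Y w)) E =
          ennreal c2 * (\<integral>\<^sup>+x. h (Y w, x) * indicator E x \<partial>K2 (Y w))"
      proof (rule AE_eq_if_nn_integral_eq[OF P Y])
        show "(\<lambda>y. ennreal c1 * emeasure (K1 y) E) \<in> borel_measurable B" by measurable
        show "(\<lambda>y. ennreal c2 * (\<integral>\<^sup>+x. h (y, x) * indicator E x \<partial>K2 y)) \<in> borel_measurable B"
          by (intro borel_measurable_times_ennreal borel_measurable_const nn_integral_measurable_subprob_algebra2[of _ B A]) measurable
        have "(\<integral>\<^sup>+w. ennreal c1 * emeasure (K1 (Y w)) E \<partial>P) \<le> (\<integral>\<^sup>+w. ennreal c1 * 1 \<partial>P)"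
          by (intro nn_integral_mono mult_left_mono sub) auto
        then show "(\<integral>\<^sup>+w. ennreal c1 * emeasure (K1 (Y w)) E \<partial>P) \<noteq> \<infinity>"
          by (auto simp: emeasure_space_1 top_unique)
        fix C assume C[measurable]: "C \<in> sets B"
        have "(\<integral>\<^sup>+w. ennreal c1 * emeasure (K1 (Y w)) E * indicator C (Y w) \<partial>P) = emeasure N1 (C \<times> E)"
        proof -
          have "emeasure N1 (C \<times> E) = ennreal c1 * (\<integral>\<^sup>+w. emeasure (K1 (Y w)) (Pair (Y w) -` (C \<times> E)) \<partial>P)"
            by (simp add: N1_def em)
          also have "\<dots> = (\<integral>\<^sup>+w. ennreal c1 * emeasure (K1 (Y w)) (Pair (Y w) -` (C \<times> E)) \<partial>P)"
            by (intro nn_integral_cmult[symmetric] meas) auto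
          also have "\<dots> = (\<integral>\<^sup>+w. ennreal c1 * emeasure (K1 (Y w)) E * indicator C (Y w) \<partial>P)"
            by (intro nn_integral_cong) (auto simp: indicator_def)
          finally show ?thesis ..
        qed
        also have "emeasure N1 (C \<times> E) = (\<integral>\<^sup>+z. h z * indicator (C \<times> E) z \<partial>N2)"
          unfolding fd'[symmetric] h_def by (rule emeasure_density) auto
        also have "\<dots> = ennreal c2 * (\<integral>\<^sup>+z. h z * indicator (C \<times> E) z \<partial>J K2)"
          unfolding N2_def by (rule nn_integral_scale_measure) (simp add: measurable_cong_sets[OF sJ refl])
        also have "(\<integral>\<^sup>+z. h z * indicator (C \<times> E) z \<partial>J K2) =
            (\<integral>\<^sup>+w. \<integral>\<^sup>+x. h (Y w, x) * indicator (C \<times> E) (Y w, x) \<partial>K2 (Y w) \<partial>P)"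
          by (rule J) measurable
        also have "ennreal c2 * \<dots> = (\<integral>\<^sup>+w. ennreal c2 * (\<integral>\<^sup>+x. h (Y w, x) * indicator (C \<times> E) (Y w, x) \<partial>K2 (Y w)) \<partial>P)"
          by (intro nn_integral_cmult[symmetric] nn_integral_measurable_subprob_algebra2[of _ P A]) measurable
        also have "\<dots> = (\<integral>\<^sup>+w. ennreal c2 * (\<integral>\<^sup>+x. h (Y w, x) * indicator E x \<partial>K2 (Y w)) * indicator C (Y w) \<partial>P)"
          by (intro nn_integral_cong) (auto simp: indicator_def)
        finally show "(\<integral>\<^sup>+w. ennreal c1 * emeasure (K1 (Y w)) E * indicator C (Y w) \<partial>P) =
          (\<integral>\<^sup>+w. ennreal c2 * (\<integral>\<^sup>+x. h (Y w, x) * indicator E x \<partial>K2 (Y w)) * indicator C (Y w) \<partial>P)" .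
      qed
    qed
  qed (rule h)
qed

subsection \<open>Regular conditional distributions\<close>

lemma measure_eqI_rectangles:
  assumes M: "sets M = sets (B \<Otimes>\<^sub>M A)" and N: "sets N = sets (B \<Otimes>\<^sub>M A)" and "finite_measure M"
    and eq: "\<And>C E. C \<in> sets B \<Longrightarrow> E \<in> sets A \<Longrightarrow> emeasure M (C \<times> E) = emeasure N (C \<times> E)"
  shows "M = N"
proof (rule measure_eqI_generator_eq[OF Int_stable_pair_measure_generator[of B A]
      pair_measure_closed, where A = "\<lambda>_. space B \<times> space A"])
  interpret finite_measure M by fact
  show "emeasure M (space B \<times> space A) \<noteq> \<infinity>" by simp
qed (use eq M N in \<open>auto simp: sets_pair_measure\<close>)

text \<open>The definition treats one set \<open>E\<close> at a time, with a null set of its own.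
  After integration over events of \<open>Y\<close> these null sets disappear: both joint laws agree
  on rectangles, hence as finite measures on the product.\<close>

lemma regular_cond_dist_nn_integral:
  assumes P: "prob_space P" and Y[measurable]: "Y \<in> P \<rightarrow>\<^sub>M B" and X[measurable]: "X \<in> P \<rightarrow>\<^sub>M A"
    and rcd: "regular_cond_dist P A X B Y \<kappa>" and f[measurable]: "f \<in> borel_measurable (B \<Otimes>\<^sub>M A)"
  shows "(\<integral>\<^sup>+w. f (Y w, X w) \<partial>P) = (\<integral>\<^sup>+w. \<integral>\<^sup>+x. f (Y w, x) \<partial>\<kappa> (Y w) \<partial>P)"
proof -
  interpret prob_space P by fact
  let ?F = "vimage_algebra (space P) Y B"
  have sub: "subalgebra P ?F"
    unfolding subalgebra_def using measurable_space[OF Y]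
    by (auto simp: sets_vimage_algebra2 Pi_iff)
  interpret F: finite_measure_subalgebra P ?F
    by standard (rule sub)
  have k: "\<kappa> \<in> B \<rightarrow>\<^sub>M prob_algebra A"
    and ce: "\<And>E. E \<in> sets A \<Longrightarrow> AE w in P. measure (\<kappa> (Y w)) E =
        real_cond_exp P ?F (indicat_real {w \<in> space P. X w \<in> E}) w"
    using rcd by (auto simp: regular_cond_dist_def)
  have k'[measurable]: "\<kappa> \<in> B \<rightarrow>\<^sub>M subprob_algebra A"
    using k by (rule measurable_prob_algebraD)
  have kp: "prob_space (\<kappa> (Y w))" if "w \<in> space P" for w
    using measurable_space[OF k measurable_space[OF Y that]] by (simp add: space_prob_algebra)
  define J where "J = P \<bind> (\<lambda>w. distr (\<kappa> (Y w)) (B \<Otimes>\<^sub>M A) (Pair (Y w)))"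
  have J: "(\<integral>\<^sup>+z. h z \<partial>J) = (\<integral>\<^sup>+w. \<integral>\<^sup>+x. h (Y w, x) \<partial>\<kappa> (Y w) \<partial>P)"
    if "h \<in> borel_measurable (B \<Otimes>\<^sub>M A)" for h
    unfolding J_def by (rule nn_integral_kernel_bind) (use that in measurable)
  have sJ: "sets J = sets (B \<Otimes>\<^sub>M A)"
    unfolding J_def using not_empty by (intro sets_bind) auto
  have "distr P (B \<Otimes>\<^sub>M A) (\<lambda>w. (Y w, X w)) = J"
  proof (rule measure_eqI_rectangles[OF _ sJ])
    show "finite_measure (distr P (B \<Otimes>\<^sub>M A) (\<lambda>w. (Y w, X w)))"
      by (rule finite_measure_distr) measurable
    fix C E assume C[measurable]: "C \<in> sets B" and E[measurable]: "E \<in> sets A"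
    let ?I = "indicat_real {w \<in> space P. X w \<in> E}" and ?S = "Y -` C \<inter> space P"
    have S: "?S \<in> sets ?F" using C measurable_space[OF Y]
      by (auto simp: sets_vimage_algebra2 Pi_iff)
    have [measurable]: "(\<lambda>w. measure (\<kappa> (Y w)) E) \<in> borel_measurable P"
      by measurable
    have le: "measure (\<kappa> (Y w)) E \<le> 1" if "w \<in> space P" for w
      using kp[OF that] by (rule prob_space.prob_le_1)
    have "measure P {w \<in> space P. Y w \<in> C \<and> X w \<in> E} = (\<integral>w\<in>?S. ?I w \<partial>P)"
    proof -
      have "(\<integral>w\<in>?S. ?I w \<partial>P) = (\<integral>w. indicat_real {w \<in> space P. Y w \<in> C \<and> X w \<in> E} w \<partial>P)"
        unfolding set_lebesgue_integral_def
        by (intro Bochner_Integration.integral_cong) (auto simp: indicator_def)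
      then show ?thesis by simp
    qed
    \<comment> \<open>\<open>?S\<close> belongs to the algebra generated by \<open>Y\<close>, so the
      indicator may be replaced by its conditional expectation, of which \<open>\<kappa>\<close> is
      a version.\<close>
    also have "\<dots> = (\<integral>w\<in>?S. real_cond_exp P ?F ?I w \<partial>P)"
      by (rule F.real_cond_exp_intA[OF _ S]) (intro integrable_const_bound[where B=1], auto)
    also have "\<dots> = (\<integral>w. indicat_real C (Y w) * measure (\<kappa> (Y w)) E \<partial>P)"
      unfolding set_lebesgue_integral_def using ce[OF E] AE_space
      by (intro integral_cong_AE, measurable) (auto simp: indicator_def)
    finally have "emeasure P {w \<in> space P. Y w \<in> C \<and> X w \<in> E} =
        ennreal (\<integral>w. indicat_real C (Y w) * measure (\<kappa> (Y w)) E \<partial>P)"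
      by (simp add: emeasure_eq_measure)
    also have "\<dots> = (\<integral>\<^sup>+w. ennreal (indicat_real C (Y w) * measure (\<kappa> (Y w)) E) \<partial>P)"
      by (intro nn_integral_eq_integral[symmetric] integrable_const_bound[where B=1] AE_I2)
         (auto simp: indicator_def le)
    also have "\<dots> = (\<integral>\<^sup>+w. \<integral>\<^sup>+x. indicator (C \<times> E) (Y w, x) \<partial>\<kappa> (Y w) \<partial>P)"
    proof (intro nn_integral_cong)
      fix w assume w: "w \<in> space P"
      interpret kw: prob_space "\<kappa> (Y w)" by (rule kp[OF w])
      have "E \<in> sets (\<kappa> (Y w))"
        using E k' measurable_space[OF Y w] by (simp add: sets_kernel)
      then have "emeasure (\<kappa> (Y w)) E = (\<integral>\<^sup>+x. indicator E x \<partial>\<kappa> (Y w))" by simp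
      then show "ennreal (indicat_real C (Y w) * measure (\<kappa> (Y w)) E) =
          (\<integral>\<^sup>+x. indicator (C \<times> E) (Y w, x) \<partial>\<kappa> (Y w))"
        by (simp add: indicator_times kw.emeasure_eq_measure split: split_indicator)
    qed
    also have "\<dots> = emeasure J (C \<times> E)"
      by (subst J[symmetric]) (auto simp: sJ)
    also have "{w \<in> space P. Y w \<in> C \<and> X w \<in> E} = (\<lambda>w. (Y w, X w)) -` (C \<times> E) \<inter> space P" by auto
    finally show "emeasure (distr P (B \<Otimes>\<^sub>M A) (\<lambda>w. (Y w, X w))) (C \<times> E) = emeasure J (C \<times> E)"
      by (subst emeasure_distr) auto
  qed simp
  then show ?thesis
    using nn_integral_distr[of "\<lambda>w. (Y w, X w)" P "B \<Otimes>\<^sub>M A" f]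
    by (simp add: J measurable_cong_sets[OF sJ refl])
qed

text \<open>Every event of the generated algebra is the preimage of some \<open>C\<close> under
  \<open>Y\<close>, so the rectangle identity is the defining property of the conditional
  expectation. Both kernels of the final condition are recognised in this way.\<close>

lemma regular_cond_distI:
  assumes Q: "prob_space Q" and Y[measurable]: "Y \<in> Q \<rightarrow>\<^sub>M B" and X[measurable]: "X \<in> Q \<rightarrow>\<^sub>M A"
    and k: "\<kappa> \<in> B \<rightarrow>\<^sub>M prob_algebra A"
    and eq: "\<And>C E. C \<in> sets B \<Longrightarrow> E \<in> sets A \<Longrightarrow>
      (\<integral>\<^sup>+w. indicator C (Y w) * indicator E (X w) \<partial>Q) =
      (\<integral>\<^sup>+w. indicator C (Y w) * emeasure (\<kappa> (Y w)) E \<partial>Q)"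
  shows "regular_cond_dist Q A X B Y \<kappa>"
  unfolding regular_cond_dist_def
proof (intro conjI ballI k)
  interpret prob_space Q by fact
  let ?F = "vimage_algebra (space Q) Y B"
  have sub: "subalgebra Q ?F"
    unfolding subalgebra_def using measurable_space[OF Y]
    by (auto simp: sets_vimage_algebra2 Pi_iff)
  interpret F: finite_measure_subalgebra Q ?F
    by standard (rule sub)
  have k'[measurable]: "\<kappa> \<in> B \<rightarrow>\<^sub>M subprob_algebra A"
    using k by (rule measurable_prob_algebraD)
  have kp: "prob_space (\<kappa> (Y w))" if "w \<in> space Q" for w
    using measurable_space[OF k measurable_space[OF Y that]] by (simp add: space_prob_algebra)
  have YF: "Y \<in> ?F \<rightarrow>\<^sub>M B"
    using measurable_space[OF Y] by (intro measurable_vimage_algebra1) auto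
  fix E assume E[measurable]: "E \<in> sets A"
  let ?I = "indicat_real {w \<in> space Q. X w \<in> E}"
  have [measurable]: "(\<lambda>w. measure (\<kappa> (Y w)) E) \<in> borel_measurable Q"
    by measurable
  have le: "measure (\<kappa> (Y w)) E \<le> 1" if "w \<in> space Q" for w
    using kp[OF that] by (rule prob_space.prob_le_1)
  have "AE w in Q. real_cond_exp Q ?F ?I w = measure (\<kappa> (Y w)) E"
  proof (rule F.real_cond_exp_charact)
    show "integrable Q ?I" by (intro integrable_const_bound[where B=1]) auto
    show "integrable Q (\<lambda>w. measure (\<kappa> (Y w)) E)"
      using le by (intro integrable_const_bound[where B=1] AE_I2) auto
    show "(\<lambda>w. measure (\<kappa> (Y w)) E) \<in> borel_measurable ?F"
      using YF by measurable
    fix S assume "S \<in> sets ?F"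
    then obtain C where C[measurable]: "C \<in> sets B" and S: "S = Y -` C \<inter> space Q"
      using measurable_space[OF Y] by (auto simp: sets_vimage_algebra2 Pi_iff)
    have "(\<integral>w\<in>S. ?I w \<partial>Q) = (\<integral>w. indicat_real C (Y w) * indicat_real E (X w) \<partial>Q)"
      unfolding set_lebesgue_integral_def S
      by (intro Bochner_Integration.integral_cong) (auto simp: indicator_def)
    also have "\<dots> = enn2real (\<integral>\<^sup>+w. ennreal (indicat_real C (Y w) * indicat_real E (X w)) \<partial>Q)"
      by (rule integral_eq_nn_integral) auto
    also have "(\<integral>\<^sup>+w. ennreal (indicat_real C (Y w) * indicat_real E (X w)) \<partial>Q) =
        (\<integral>\<^sup>+w. indicator C (Y w) * indicator E (X w) \<partial>Q)"
      by (intro nn_integral_cong) (auto simp: indicator_def)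
    also have "\<dots> = (\<integral>\<^sup>+w. indicator C (Y w) * emeasure (\<kappa> (Y w)) E \<partial>Q)"
      by (rule eq) (fact C E)+
    also have "\<dots> = (\<integral>\<^sup>+w. ennreal (indicat_real C (Y w) * measure (\<kappa> (Y w)) E) \<partial>Q)"
    proof (intro nn_integral_cong)
      fix w assume w: "w \<in> space Q"
      interpret kw: prob_space "\<kappa> (Y w)" by (rule kp[OF w])
      show "indicator C (Y w) * emeasure (\<kappa> (Y w)) E = ennreal (indicat_real C (Y w) * measure (\<kappa> (Y w)) E)"
        by (simp add: kw.emeasure_eq_measure split: split_indicator)
    qed
    also have "enn2real \<dots> = (\<integral>w. indicat_real C (Y w) * measure (\<kappa> (Y w)) E \<partial>Q)"
      by (rule integral_eq_nn_integral[symmetric]) auto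
    also have "\<dots> = (\<integral>w\<in>S. measure (\<kappa> (Y w)) E \<partial>Q)"
      unfolding set_lebesgue_integral_def S
      by (intro Bochner_Integration.integral_cong) (auto simp: indicator_def)
    finally show "(\<integral>w\<in>S. ?I w \<partial>Q) = (\<integral>w\<in>S. measure (\<kappa> (Y w)) E \<partial>Q)" .
  qed
  then show "AE w in Q. measure (\<kappa> (Y w)) E = real_cond_exp Q ?F ?I w"
    by eventually_elim simp
qed

text \<open>The null set in the hypothesis depends on \<open>E\<close>, so nothing can be concluded
  fibre by fibre. Integrated, the hypothesis says that the joint law \<open>M\<close> of
  \<open>(Y, X)\<close> has density \<open>\<Sum>k. g k\<close> with respect to itself, and
  uniqueness of finite densities forces the value 1 at \<open>M\<close>-almost every point.\<close>

lemma suminf_densities_eq_1: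
  assumes P: "prob_space P" and Y[measurable]: "Y \<in> P \<rightarrow>\<^sub>M B" and X[measurable]: "X \<in> P \<rightarrow>\<^sub>M A"
    and rcd: "regular_cond_dist P A X B Y \<kappa>"
    and g[measurable]: "\<And>k::nat. g k \<in> borel_measurable (B \<Otimes>\<^sub>M A)"
    and sum: "\<And>E. E \<in> sets A \<Longrightarrow> AE w in P.
      (\<Sum>k. \<integral>\<^sup>+x. g k (Y w, x) * indicator E x \<partial>\<kappa> (Y w)) = emeasure (\<kappa> (Y w)) E"
  shows "AE w in P. (\<Sum>k. g k (Y w, X w)) = (1::ennreal)"
proof -
  interpret prob_space P by fact
  note dis = regular_cond_dist_nn_integral[OF P Y X rcd]
  have k'[measurable]: "\<kappa> \<in> B \<rightarrow>\<^sub>M subprob_algebra A"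
    using rcd by (auto simp: regular_cond_dist_def intro: measurable_prob_algebraD)
  have sk: "sets (\<kappa> (Y w)) = sets A" if "w \<in> space P" for w
    using sets_kernel[OF k' measurable_space[OF Y that]] .
  define M where "M = distr P (B \<Otimes>\<^sub>M A) (\<lambda>w. (Y w, X w))"
  have sM[measurable_cong]: "sets M = sets (B \<Otimes>\<^sub>M A)" by (simp add: M_def)
  have fM: "finite_measure M" unfolding M_def by (rule finite_measure_distr) measurable
  have M: "(\<integral>\<^sup>+z. f z \<partial>M) = (\<integral>\<^sup>+w. \<integral>\<^sup>+x. f (Y w, x) \<partial>\<kappa> (Y w) \<partial>P)"
    if [measurable]: "f \<in> borel_measurable (B \<Otimes>\<^sub>M A)" for f
    unfolding M_def dis[OF that, symmetric] by (simp add: nn_integral_distr)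
  have "M = density M (\<lambda>z. \<Sum>k. g k z)"
  proof (rule measure_eqI_rectangles[OF sM _ fM])
    fix C E assume C[measurable]: "C \<in> sets B" and E[measurable]: "E \<in> sets A"
    have "emeasure (density M (\<lambda>z. \<Sum>k. g k z)) (C \<times> E) =
        (\<integral>\<^sup>+z. (\<Sum>k. g k z) * indicator (C \<times> E) z \<partial>M)"
      by (rule emeasure_density) auto
    also have "\<dots> = (\<integral>\<^sup>+w. \<integral>\<^sup>+x. (\<Sum>k. g k (Y w, x)) * indicator (C \<times> E) (Y w, x) \<partial>\<kappa> (Y w) \<partial>P)"
      by (rule M) measurable
    also have "\<dots> = (\<integral>\<^sup>+w. \<integral>\<^sup>+x. indicator (C \<times> E) (Y w, x) \<partial>\<kappa> (Y w) \<partial>P)"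
    proof (rule nn_integral_cong_AE)
      show "AE w in P. (\<integral>\<^sup>+x. (\<Sum>k. g k (Y w, x)) * indicator (C \<times> E) (Y w, x) \<partial>\<kappa> (Y w)) =
          (\<integral>\<^sup>+x. indicator (C \<times> E) (Y w, x) \<partial>\<kappa> (Y w))"
        using sum[OF E] AE_space
      proof eventually_elim
        case (elim w)
        note [measurable_cong] = sk[OF elim(2)]
        have [simp]: "Y w \<in> space B" using measurable_space[OF Y elim(2)] .
        have "(\<integral>\<^sup>+x. (\<Sum>k. g k (Y w, x)) * indicator E x \<partial>\<kappa> (Y w)) =
            (\<integral>\<^sup>+x. (\<Sum>k. g k (Y w, x) * indicator E x) \<partial>\<kappa> (Y w))"
          by simp
        also have "\<dots> = (\<Sum>k. \<integral>\<^sup>+x. g k (Y w, x) * indicator E x \<partial>\<kappa> (Y w))"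
          by (rule nn_integral_suminf) measurable
        also have "\<dots> = (\<integral>\<^sup>+x. indicator E x \<partial>\<kappa> (Y w))"
          using elim(1) by simp
        finally show ?case
          by (simp add: indicator_times split: split_indicator)
      qed
    qed
    also have "\<dots> = emeasure M (C \<times> E)"
      by (subst M[symmetric]) auto
    finally show "emeasure M (C \<times> E) = emeasure (density M (\<lambda>z. \<Sum>k. g k z)) (C \<times> E)" ..
  qed (simp add: sM)
  then have "density M (\<lambda>z. 1) = density M (\<lambda>z. \<Sum>k. g k z)"
    by (simp add: density_1)
  then have "AE z in M. 1 = (\<Sum>k. g k z)"
    using finite_measure.emeasure_finite[OF fM]
    by (subst (asm) finite_density_unique) auto
  then show ?thesis
    unfolding M_def by (subst (asm) AE_distr_iff) (auto elim: eventually_mono)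
qed

text \<open>The difference cannot be taken pointwise: on an alphabet that is not countably generated,
  the set of values of \<open>Y\<close> at which the domination fails need not lie in a measurable null set. The
  density from \<open>density_of_dominated_kernel\<close> is jointly measurable and gives a kernel everywhere.\<close>

lemma kernel_difference:
  fixes c1 c2 :: real
  assumes P: "prob_space P" and Y[measurable]: "Y \<in> P \<rightarrow>\<^sub>M B"
    and K1: "K1 \<in> B \<rightarrow>\<^sub>M prob_algebra A" and K2: "K2 \<in> B \<rightarrow>\<^sub>M prob_algebra A"
    and c: "0 \<le> c1" "c1 < c2"
    and dom: "AE w in P. \<forall>E\<in>sets A.
      ennreal c1 * emeasure (K1 (Y w)) E \<le> ennreal c2 * emeasure (K2 (Y w)) E"
  obtains K where "K \<in> B \<rightarrow>\<^sub>M prob_algebra A"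
    "\<forall>E\<in>sets A. AE w in P. ennreal (c2 - c1) * emeasure (K (Y w)) E +
        ennreal c1 * emeasure (K1 (Y w)) E = ennreal c2 * emeasure (K2 (Y w)) E"
    "AE w in P. \<forall>E\<in>sets A.
      ennreal (c2 - c1) * emeasure (K (Y w)) E \<le> ennreal c2 * emeasure (K2 (Y w)) E"
proof -
  interpret prob_space P by fact
  note K1'[measurable] = measurable_prob_algebraD[OF K1]
  note K2'[measurable] = measurable_prob_algebraD[OF K2]
  obtain h where h[measurable]: "h \<in> borel_measurable (B \<Otimes>\<^sub>M A)" and h1: "\<forall>z. h z \<le> (1::ennreal)"
    and hE: "\<forall>E\<in>sets A. AE w in P. ennreal c1 * emeasure (K1 (Y w)) E =
        ennreal c2 * (\<integral>\<^sup>+x. h (Y w, x) * indicator E x \<partial>K2 (Y w))"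
    by (rule density_of_dominated_kernel[OF P Y K1' K2' dom])
  \<comment> \<open>The difference of \<open>c2 K2\<close> and \<open>c1 K1\<close> has mass
    \<open>c2 - c1\<close>; the factor \<open>r\<close> turns \<open>1 - h\<close> into a
    probability density with respect to \<open>K2\<close>, almost surely.\<close>
  define r where "r = ennreal (c2 / (c2 - c1))"
  have r: "ennreal (c2 - c1) * r = ennreal c2"
    unfolding r_def using c by (subst ennreal_mult[symmetric]) auto
  define K0 where "K0 y = density (K2 y) (\<lambda>x. r * (1 - h (y, x)))" for y
  \<comment> \<open>The mass is 1 only almost surely; elsewhere \<open>K2 y\<close> is the default,
    so that \<open>K\<close> is a probability kernel everywhere. The case split is measurable
    because it looks only at the total mass.\<close>
  define K where "K y = (if emeasure (K0 y) (space A) = 1 then K0 y else K2 y)" for y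
  have sK2: "sets (K2 y) = sets A" if "y \<in> space B" for y
    using sets_kernel[OF K2' that] .
  have pK: "prob_space (K1 y)" "prob_space (K2 y)" if "y \<in> space B" for y
    using measurable_space[OF K1 that] measurable_space[OF K2 that] by (simp_all add: space_prob_algebra)
  have sp1: "emeasure (K1 y) (space A) = 1" "emeasure (K2 y) (space A) = 1" if "y \<in> space B" for y
    using pK[OF that, THEN prob_space.emeasure_space_1]
      sets_kernel[OF K1' that, THEN sets_eq_imp_space_eq] sets_kernel[OF K2' that, THEN sets_eq_imp_space_eq]
    by simp_all
  have K0E: "emeasure (K0 y) E = r * (\<integral>\<^sup>+x. (1 - h (y, x)) * indicator E x \<partial>K2 y)"
    if y[simp]: "y \<in> space B" and E[measurable]: "E \<in> sets A" for y E
  proof -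
    note [measurable_cong] = sK2[OF y]
    have "emeasure (K0 y) E = (\<integral>\<^sup>+x. r * (1 - h (y, x)) * indicator E x \<partial>K2 y)"
      unfolding K0_def by (rule emeasure_density) measurable
    also have "\<dots> = (\<integral>\<^sup>+x. r * ((1 - h (y, x)) * indicator E x) \<partial>K2 y)"
      by (simp add: mult.assoc)
    also have "\<dots> = r * (\<integral>\<^sup>+x. (1 - h (y, x)) * indicator E x \<partial>K2 y)"
      by (rule nn_integral_cmult) measurable
    finally show ?thesis .
  qed
  have K0m[measurable]: "(\<lambda>y. emeasure (K0 y) E) \<in> borel_measurable B" if [measurable]: "E \<in> sets A" for E
    by (subst measurable_cong[OF K0E[OF _ that]], assumption)
       (intro borel_measurable_times_ennreal borel_measurable_const nn_integral_measurable_subprob_algebra2[of _ B A], measurable)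
  have spK0: "space (K0 y) = space A" if "y \<in> space B" for y
    unfolding K0_def using sets_eq_imp_space_eq[OF sK2[OF that]] by simp
  have KM: "K \<in> B \<rightarrow>\<^sub>M prob_algebra A"
  proof (rule measurable_prob_algebraI)
    show p: "prob_space (K y)" if "y \<in> space B" for y
      using that by (auto simp: K_def pK spK0 intro!: prob_spaceI)
    show "K \<in> B \<rightarrow>\<^sub>M subprob_algebra A"
    proof (rule measurable_subprob_algebra)
      fix y assume y: "y \<in> space B"
      show "subprob_space (K y)" using p[OF y] by (rule prob_space_imp_subprob_space)
      show "sets (K y) = sets A" using sK2[OF y] by (auto simp: K_def K0_def)
    next
      fix E assume [measurable]: "E \<in> sets A"
      show "(\<lambda>y. emeasure (K y) E) \<in> borel_measurable B"
        unfolding K_def if_distrib[of "\<lambda>M. emeasure M E"] by measurable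
    qed
  qed
  have eq0: "AE w in P. ennreal (c2 - c1) * emeasure (K0 (Y w)) E +
        ennreal c1 * emeasure (K1 (Y w)) E = ennreal c2 * emeasure (K2 (Y w)) E"
    if E[measurable]: "E \<in> sets A" for E
    using bspec[OF hE E] AE_space
  proof eventually_elim
    case (elim w)
    then have y[simp]: "Y w \<in> space B" using measurable_space[OF Y] by auto
    note [measurable_cong] = sK2[OF y]
    have "(\<integral>\<^sup>+x. (1 - h (Y w, x)) * indicator E x \<partial>K2 (Y w)) + (\<integral>\<^sup>+x. h (Y w, x) * indicator E x \<partial>K2 (Y w)) =
       (\<integral>\<^sup>+x. (1 - h (Y w, x)) * indicator E x + h (Y w, x) * indicator E x \<partial>K2 (Y w))"
      by (rule nn_integral_add[symmetric]) measurable
    also have "\<dots> = (\<integral>\<^sup>+x. indicator E x \<partial>K2 (Y w))"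
      by (intro nn_integral_cong) (simp add: h1 diff_add_cancel_ennreal flip: distrib_right)
    also have "\<dots> = emeasure (K2 (Y w)) E" by simp
    finally show ?case
      by (simp add: elim(1) K0E E mult.assoc[symmetric] r flip: distrib_left)
  qed
  have norm: "AE w in P. emeasure (K0 (Y w)) (space A) = 1"
    using eq0[OF sets.top] AE_space
  proof eventually_elim
    case (elim w)
    then have y: "Y w \<in> space B" using measurable_space[OF Y] by auto
    have "ennreal (c2 - c1) * emeasure (K0 (Y w)) (space A) + ennreal c1 = ennreal (c2 - c1) * 1 + ennreal c1"
      using elim(1) c by (simp add: sp1[OF y] flip: ennreal_plus)
    then show ?case
      using c ennreal_mult_cancel_left[of "ennreal (c2 - c1)" _ 1] by simp
  qed
  show thesis
  proof (rule that[OF KM])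
    show "\<forall>E\<in>sets A. AE w in P. ennreal (c2 - c1) * emeasure (K (Y w)) E +
        ennreal c1 * emeasure (K1 (Y w)) E = ennreal c2 * emeasure (K2 (Y w)) E"
    proof
      fix E assume E: "E \<in> sets A"
      show "AE w in P. ennreal (c2 - c1) * emeasure (K (Y w)) E +
          ennreal c1 * emeasure (K1 (Y w)) E = ennreal c2 * emeasure (K2 (Y w)) E"
        using eq0[OF E] norm by eventually_elim (simp add: K_def)
    qed
  next
    \<comment> \<open>Unlike the identity above, this bound has one null set for all
      \<open>E\<close>: where the normalisation holds, it follows from \<open>1 - h \<le> 1\<close>
      pointwise. The later construction of densities with respect to the full conditional law relies
      on this uniformity.\<close>
    show "AE w in P. \<forall>E\<in>sets A.
      ennreal (c2 - c1) * emeasure (K (Y w)) E \<le> ennreal c2 * emeasure (K2 (Y w)) E"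
      using norm AE_space
    proof eventually_elim
      case (elim w)
      then have y[simp]: "Y w \<in> space B" using measurable_space[OF Y] by auto
      show ?case
      proof
        fix E assume E: "E \<in> sets A"
        then have E': "E \<in> sets (K2 (Y w))" by (simp add: sK2)
        have "(\<integral>\<^sup>+x. (1 - h (Y w, x)) * indicator E x \<partial>K2 (Y w)) \<le> (\<integral>\<^sup>+x. indicator E x \<partial>K2 (Y w))"
          by (intro nn_integral_mono) (auto simp: indicator_def diff_le_self_ennreal)
        also have "\<dots> = emeasure (K2 (Y w)) E" using E' by simp
        finally show "ennreal (c2 - c1) * emeasure (K (Y w)) E \<le> ennreal c2 * emeasure (K2 (Y w)) E"
          by (simp add: K_def elim(1) K0E E mult.assoc[symmetric] r mult_left_mono)
      qed
    qed
  qed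
qed

subsection \<open>The random-step decomposition of the conditional law\<close>

text \<open>Clearing the denominator absorbs the convention for 0 / 0: if \<open>q\<close> vanishes,
  so does \<open>p\<close>, and both bounds are trivial.\<close>

lemma prob_ratio_bounds:
  assumes "0 \<le> p" "0 \<le> q" "q = 0 \<longrightarrow> p = 0" "\<bar>prob_ratio p q - 1\<bar> < \<epsilon>"
  shows "(1 - \<epsilon>) * q \<le> p" "p \<le> (1 + \<epsilon>) * q"
proof -
  have "(1 - \<epsilon>) * q \<le> p \<and> p \<le> (1 + \<epsilon>) * q"
  proof (cases "q = 0")
    case False
    then have "0 < q" and "\<bar>p / q - 1\<bar> < \<epsilon>" using assms by (auto simp: prob_ratio_def)
    then have "1 - \<epsilon> < p / q" "p / q < 1 + \<epsilon>" by linarith+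
    with \<open>0 < q\<close> show ?thesis by (simp add: field_simps)
  qed (use assms in auto)
  then show "(1 - \<epsilon>) * q \<le> p" "p \<le> (1 + \<epsilon>) * q" by auto
qed

section \<open>Weights and tolerances\<close>

definition tol :: "nat \<Rightarrow> real" where "tol k = 1 / (2 * (real k + 1)\<^sup>2)"

definition lvl :: "nat \<Rightarrow> real" where "lvl k = real k / (real k + 1)"

lemma tol_pos: "0 < tol k"
proof -
  have "real k + 1 \<noteq> 0" by linarith
  then show ?thesis by (simp add: tol_def)
qed

lemma tol_le: "tol k \<le> 1 / (real k + 1)"
proof -
  have "real k + 1 \<le> 2 * (real k + 1)\<^sup>2" by (simp add: power2_eq_square algebra_simps)
  then show ?thesis unfolding tol_def by (intro divide_left_mono mult_pos_pos) auto
qed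

lemma lvl_less_Suc: "lvl k < lvl (Suc k)"
  by (simp add: lvl_def divide_simps algebra_simps)

lemma lvl_nonneg: "0 \<le> lvl k" by (simp add: lvl_def)

text \<open>With \<open>N = (k + 1)\<^sup>2\<close>, the ratio of consecutive weights is
  \<open>(N - 1) / N\<close>, because \<open>k (k + 2) = N - 1\<close>. Comparing both sides with
  the common value \<open>x\<close> leaves the condition
  \<open>(N - 1) (1 + e) \<le> N (1 - e)\<close>, that is \<open>e \<le> 1 / (2 N - 1)\<close>,
  which \<open>tol k = 1 / (2 N)\<close> satisfies.\<close>

lemma lvl_mult_le_Suc:
  assumes "(1 - tol k) * a \<le> x" "x \<le> (1 + tol (Suc k)) * b" "0 \<le> (b::real)"
  shows "lvl k * a \<le> lvl (Suc k) * b"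
proof -
  define N where "N = (real k + 1)\<^sup>2"
  define e where "e = tol k"
  have N: "1 \<le> N" "real k * (real k + 2) = N - 1"
    by (auto simp: N_def power2_eq_square algebra_simps)
  have Ne: "N * e = 1 / 2" and e0: "0 < e"
    using N tol_pos[of k] by (auto simp: e_def tol_def N_def)
  have "1 * e \<le> N * e" using N(1) e0 by (intro mult_right_mono) auto
  then have e1: "e < 1" using Ne by simp
  \<comment> \<open>The tolerances decrease, so the single error \<open>e\<close> serves for both
    levels.\<close>
  have "tol (Suc k) \<le> e"
    unfolding e_def tol_def by (intro divide_left_mono mult_left_mono power_mono) auto
  then have "(1 + tol (Suc k)) * b \<le> (1 + e) * b"
    using assms(3) by (intro mult_right_mono) auto
  then have "(1 - e) * a \<le> (1 + e) * b"
    using assms(1,2) unfolding e_def[symmetric] by linarith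
  then have "(N - 1) * ((1 - e) * a) \<le> (N - 1) * ((1 + e) * b)"
    using N by (intro mult_left_mono) auto
  also have "\<dots> = ((N - 1) * (1 + e)) * b" by simp
  also have "\<dots> \<le> (N * (1 - e)) * b"
  proof (rule mult_right_mono[OF _ assms(3)])
    have "(N - 1) * (1 + e) = N + N * e - 1 - e" "N * (1 - e) = N - N * e"
      by (auto simp: algebra_simps)
    then show "(N - 1) * (1 + e) \<le> N * (1 - e)" using Ne e0 by simp
  qed
  finally have "(1 - e) * ((N - 1) * a) \<le> (1 - e) * (N * b)" by (simp only: mult_ac)
  then have le: "(N - 1) * a \<le> N * b" using e1 by (subst (asm) mult_le_cancel_left_pos) auto
  have pos: "0 < (real k + 1) * (real k + 2)" by (simp add: add_pos_nonneg)
  have "lvl k * a = (N - 1) * a / ((real k + 1) * (real k + 2))"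
    unfolding N(2)[symmetric] by (simp add: lvl_def)
  also have "\<dots> \<le> N * b / ((real k + 1) * (real k + 2))"
    using le pos by (intro divide_right_mono) auto
  also have "\<dots> = lvl (Suc k) * b"
    by (simp add: lvl_def N_def power2_eq_square add.commute)
  finally show ?thesis .
qed

lemma lvl_mult_le:
  assumes "(1 - tol k) * a \<le> x" "0 \<le> (a::real)"
  shows "lvl k * a \<le> x"
proof -
  have "lvl k = 1 - 1 / (real k + 1)" by (simp add: lvl_def field_simps)
  also have "\<dots> \<le> 1 - tol k" using tol_le[of k] by simp
  finally have "lvl k * a \<le> (1 - tol k) * a" using assms by (intro mult_right_mono)
  with assms show ?thesis by simp
qed

lemma lvl_tendsto: "lvl \<longlonglongrightarrow> 1"
  using LIMSEQ_n_over_Suc_n[where 'a = real] unfolding lvl_def[abs_def] by (simp add: add.commute)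

lemma tol_tendsto: "tol \<longlonglongrightarrow> 0"
proof (rule tendsto_sandwich[OF _ _ tendsto_const])
  show "(\<lambda>k. 1 / (real k + 1)) \<longlonglongrightarrow> 0"
    using LIMSEQ_Suc[OF lim_1_over_n[where 'a = real]] by (simp add: add.commute)
qed (simp_all add: tol_le less_imp_le[OF tol_pos])

text \<open>A squeeze between \<open>lvl k * x / (1 + tol k)\<close> and the constant
  \<open>x\<close>; the upper bound rests on \<open>lvl k \<le> 1 - tol k\<close>.\<close>

lemma lvl_mult_tendsto:
  assumes "\<And>k. (1 - tol k) * a k \<le> x" "\<And>k. x \<le> (1 + tol k) * a k" "\<And>k. 0 \<le> a k"
  shows "(\<lambda>k. lvl k * a k) \<longlonglongrightarrow> x"
proof (rule tendsto_sandwich)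
  have "lvl k * x / (1 + tol k) \<le> lvl k * a k" for k
    using mult_left_mono[OF assms(2)[of k] lvl_nonneg[of k]] tol_pos[of k]
    by (simp add: divide_simps algebra_simps add_pos_pos)
  then show "\<forall>\<^sub>F k in sequentially. lvl k * x / (1 + tol k) \<le> lvl k * a k" by simp
  show "\<forall>\<^sub>F k in sequentially. lvl k * a k \<le> x"
    using lvl_mult_le[OF assms(1) assms(3)] by simp
  have "(\<lambda>k. lvl k * x / (1 + tol k)) \<longlonglongrightarrow> 1 * x / (1 + 0)"
    by (intro tendsto_intros lvl_tendsto tol_tendsto) simp
  then show "(\<lambda>k. lvl k * x / (1 + tol k)) \<longlonglongrightarrow> x" by simp
qed simp

section \<open>Kernels obtained from the ratio condition\<close>

lemma berbee_kernels:
  assumes "berbee_ratio_condition A P"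
  obtains \<kappa> n q where
    "regular_cond_dist P A (\<lambda>w. w 0) (Pi\<^sub>M past (\<lambda>_. A)) (\<lambda>w. restrict w past) \<kappa>"
    "\<And>k::nat. 0 < n k"
    "\<And>k. q k \<in> Pi\<^sub>M (past_upto (n k)) (\<lambda>_. A) \<rightarrow>\<^sub>M prob_algebra A"
    "AE w in P. \<forall>k. \<forall>E\<in>sets A.
      (1 - tol k) * measure (q k (restrict w (past_upto (n k)))) E \<le> measure (\<kappa> (restrict w past)) E \<and>
      measure (\<kappa> (restrict w past)) E \<le> (1 + tol k) * measure (q k (restrict w (past_upto (n k)))) E"
proof -
  from assms obtain \<kappa> where rcd:
      "regular_cond_dist P A (\<lambda>w. w 0) (Pi\<^sub>M past (\<lambda>_. A)) (\<lambda>w. restrict w past) \<kappa>"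
    and *: "\<And>\<epsilon>. \<epsilon> > 0 \<Longrightarrow> \<exists>n>0. \<exists>\<kappa>n.
          regular_cond_dist P A (\<lambda>\<omega>. \<omega> 0)
            (Pi\<^sub>M (past_upto n) (\<lambda>_. A)) (\<lambda>\<omega>. restrict \<omega> (past_upto n)) \<kappa>n \<and>
          (AE \<omega> in P. \<forall>E\<in>sets A.
             (let p = measure (\<kappa> (restrict \<omega> past)) E;
                  q = measure (\<kappa>n (restrict \<omega> (past_upto n))) E
              in (q = 0 \<longrightarrow> p = 0) \<and> \<bar>prob_ratio p q - 1\<bar> < \<epsilon>))"
    unfolding berbee_ratio_condition_def by blast
  \<comment> \<open>\<open>good\<close> bundles the length with the kernel, whose domain depends on
    it, so that both are chosen together for each \<open>k\<close>. Since there are countably many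
    tolerances, one null set then serves all of them.\<close>
  define good where "good k n \<kappa>n \<longleftrightarrow> 
     \<kappa>n \<in> Pi\<^sub>M (past_upto n) (\<lambda>_. A) \<rightarrow>\<^sub>M prob_algebra A \<and>
     (AE w in P. \<forall>E\<in>sets A.
      (1 - tol k) * measure (\<kappa>n (restrict w (past_upto n))) E \<le> measure (\<kappa> (restrict w past)) E \<and>
      measure (\<kappa> (restrict w past)) E \<le> (1 + tol k) * measure (\<kappa>n (restrict w (past_upto n))) E)" for k n \<kappa>n
  have "\<exists>n \<kappa>n. 0 < n \<and> good k n \<kappa>n" for k
  proof -
    from *[OF tol_pos[of k]] obtain n \<kappa>n where n: "0 < n"
      and r: "regular_cond_dist P A (\<lambda>\<omega>. \<omega> 0)
            (Pi\<^sub>M (past_upto n) (\<lambda>_. A)) (\<lambda>\<omega>. restrict \<omega> (past_upto n)) \<kappa>n"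
      and ae: "AE \<omega> in P. \<forall>E\<in>sets A.
             (let p = measure (\<kappa> (restrict \<omega> past)) E;
                  q = measure (\<kappa>n (restrict \<omega> (past_upto n))) E
              in (q = 0 \<longrightarrow> p = 0) \<and> \<bar>prob_ratio p q - 1\<bar> < tol k)" by blast
    have "good k n \<kappa>n"
      unfolding good_def
    proof
      show "AE w in P. \<forall>E\<in>sets A.
        (1 - tol k) * measure (\<kappa>n (restrict w (past_upto n))) E \<le> measure (\<kappa> (restrict w past)) E \<and>
        measure (\<kappa> (restrict w past)) E \<le> (1 + tol k) * measure (\<kappa>n (restrict w (past_upto n))) E"
        using ae by eventually_elim (auto simp: Let_def intro!: prob_ratio_bounds)
    qed (use r in \<open>simp add: regular_cond_dist_def\<close>)
    with n show ?thesis by blast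
  qed
  then obtain n q where "\<And>k. 0 < n k" "\<And>k. good k (n k) (q k)" by metis
  then show thesis
    by (intro that[OF rcd, of n q]) (auto simp: good_def AE_all_countable)
qed

text \<open>The interface between the analytic part and the coupling; the law of \<open>X_0\<close>
  given the infinite past no longer occurs. In \<open>g_cond\<close>, the whole alphabet as
  \<open>E\<close> gives the conditional mean of \<open>g k\<close>, and general \<open>E\<close>
  gives the law of \<open>X_0\<close> once the step is known. As \<open>m\<close> is injective, a
  step equal to \<open>m k\<close> singles out the kernel \<open>\<mu> k\<close>.\<close>

locale random_step_data =
  fixes A :: "'a measure" and P :: "(int \<Rightarrow> 'a) measure"
    and m :: "nat \<Rightarrow> nat" and p :: "nat \<Rightarrow> real" and \<mu> g
  assumes stationary: "stationary_process A P"
    and m: "strict_mono m" "0 < m 0" and p_pos: "\<And>k. 0 < p k"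
    and \<mu>: "\<And>k. \<mu> k \<in> Pi\<^sub>M (past_upto (m k)) (\<lambda>_. A) \<rightarrow>\<^sub>M prob_algebra A"
    and g[measurable]: "\<And>k. g k \<in> borel_measurable (Pi\<^sub>M past (\<lambda>_. A) \<Otimes>\<^sub>M A)"
    and sum_g: "AE w in P. (\<Sum>k. g k (restrict w past, w 0)) = (1::ennreal)"
    and g_cond: "\<And>k \<phi> E. \<phi> \<in> borel_measurable (Pi\<^sub>M past (\<lambda>_. A)) \<Longrightarrow> E \<in> sets A \<Longrightarrow>
      (\<integral>\<^sup>+w. \<phi> (restrict w past) * indicator E (w 0) * g k (restrict w past, w 0) \<partial>P) =
      ennreal (p k) * (\<integral>\<^sup>+w. \<phi> (restrict w past) *
        emeasure (\<mu> k (restrict w (past_upto (m k)))) E \<partial>P)"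

proposition random_step_data_exists:
  assumes stat: "stationary_process A P" and berbee: "berbee_ratio_condition A P"
  shows "\<exists>m p \<mu> g. random_step_data A P m p \<mu> g"
proof -
  have P: "prob_space P" and sP: "sets P = sets (seq_space A)"
    using stat by (auto simp: stationary_process_def)
  interpret prob_space P by fact
  note [measurable_cong] = sP[unfolded seq_space_def]
  let ?B = "\<lambda>I::int set. Pi\<^sub>M I (\<lambda>_. A)"
  have resP[measurable]: "(\<lambda>w. restrict w I) \<in> P \<rightarrow>\<^sub>M ?B I" for I
    unfolding measurable_cong_sets[OF sP refl] seq_space_def by (rule measurable_restrict_subset) simp
  have res: "(\<lambda>y. restrict y I) \<in> ?B J \<rightarrow>\<^sub>M ?B I" if "I \<subseteq> J" for I J
    using that by (rule measurable_restrict_subset)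
  obtain \<kappa> n q where
    rcd: "regular_cond_dist P A (\<lambda>w. w 0) (?B past) (\<lambda>w. restrict w past) \<kappa>"
    and n: "\<And>k. 0 < n k"
    and q: "\<And>k::nat. q k \<in> ?B (past_upto (n k)) \<rightarrow>\<^sub>M prob_algebra A"
    and bd: "AE w in P. \<forall>k. \<forall>E\<in>sets A.
      (1 - tol k) * measure (q k (restrict w (past_upto (n k)))) E \<le> measure (\<kappa> (restrict w past)) E \<and>
      measure (\<kappa> (restrict w past)) E \<le> (1 + tol k) * measure (q k (restrict w (past_upto (n k)))) E"
    using berbee_kernels[OF berbee] by blast
  have \<kappa>: "\<kappa> \<in> ?B past \<rightarrow>\<^sub>M prob_algebra A" using rcd by (simp add: regular_cond_dist_def)
  note \<kappa>'[measurable] = measurable_prob_algebraD[OF \<kappa>]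
  define x where "x w E = measure (\<kappa> (restrict w past)) E" for w E
  define a where "a k w E = measure (q k (restrict w (past_upto (n k)))) E" for k w E
  have em\<kappa>: "emeasure (\<kappa> (restrict w past)) E = ennreal (x w E)" if "w \<in> space P" for w E
  proof -
    have "restrict w past \<in> space (?B past)"
      by (rule measurable_space[OF _ that]) measurable
    then have "prob_space (\<kappa> (restrict w past))"
      using measurable_space[OF \<kappa>] by (auto simp: space_prob_algebra)
    then interpret kw: prob_space "\<kappa> (restrict w past)" .
    show ?thesis by (simp add: x_def kw.emeasure_eq_measure)
  qed
  have emq: "emeasure (q k (restrict w (past_upto (n k)))) E = ennreal (a k w E)" if "w \<in> space P" for w k E
  proof -
    have "restrict w (past_upto (n k)) \<in> space (?B (past_upto (n k)))"
      by (rule measurable_space[OF _ that]) measurable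
    then have "prob_space (q k (restrict w (past_upto (n k))))"
      using measurable_space[OF q] by (auto simp: space_prob_algebra)
    then interpret kw: prob_space "q k (restrict w (past_upto (n k)))" .
    show ?thesis by (simp add: a_def kw.emeasure_eq_measure)
  qed
  have a0: "0 \<le> a k w E" "0 \<le> x w E" for k w E by (simp_all add: a_def x_def)
  note bd = bd[folded a_def x_def]
  \<comment> \<open>The lengths \<open>n k\<close> need not increase. Their partial sums do, as each
    \<open>n k\<close> is positive, and \<open>m k\<close> covers both \<open>n k\<close> and
    \<open>n (Suc k)\<close>, the two pasts that enter the increment from level \<open>k\<close> to
    level \<open>Suc k\<close>.\<close>
  define m where "m k = (\<Sum>j\<le>Suc k. n j)" for k
  have m: "strict_mono m" "0 < m 0"
    using n by (auto simp: m_def strict_mono_Suc_iff intro: add_pos_pos)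
  have nm: "n k \<le> m k" "n (Suc k) \<le> m k" for k
    by (auto simp: m_def intro: member_le_sum trans_le_add1)
  have sub: "past_upto (n k) \<subseteq> past_upto (m k)" "past_upto (n (Suc k)) \<subseteq> past_upto (m k)" for k
    using nm[of k] by auto
  define p where "p k = lvl (Suc k) - lvl k" for k
  have p: "0 < p k" for k using lvl_less_Suc[of k] by (simp add: p_def)
  \<comment> \<open>The two conclusions differ in the order of quantifiers. The identity, for one
    \<open>E\<close> at a time, yields the telescoping sum; the bound, for all \<open>E\<close> at
    once, yields a density with respect to \<open>\<kappa>\<close>.\<close>
  have "\<forall>k. \<exists>K. K \<in> ?B (past_upto (m k)) \<rightarrow>\<^sub>M prob_algebra A \<and>
    (\<forall>E\<in>sets A. AE w in P. ennreal (p k) * emeasure (K (restrict w (past_upto (m k)))) E +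
        ennreal (lvl k * a k w E) = ennreal (lvl (Suc k) * a (Suc k) w E)) \<and>
    (AE w in P. \<forall>E\<in>sets A.
      ennreal (p k) * emeasure (K (restrict w (past_upto (m k)))) E \<le> ennreal (lvl (Suc k) * a (Suc k) w E))"
  proof
    fix k
    define K1 where "K1 y = q k (restrict y (past_upto (n k)))" for y
    define K2 where "K2 y = q (Suc k) (restrict y (past_upto (n (Suc k))))" for y
    have K: "K1 \<in> ?B (past_upto (m k)) \<rightarrow>\<^sub>M prob_algebra A" "K2 \<in> ?B (past_upto (m k)) \<rightarrow>\<^sub>M prob_algebra A"
      unfolding K1_def K2_def by (rule measurable_compose[OF res q], rule sub)+
    have KE: "ennreal (lvl k) * emeasure (K1 (restrict w (past_upto (m k)))) E = ennreal (lvl k * a k w E)"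
      "ennreal (lvl (Suc k)) * emeasure (K2 (restrict w (past_upto (m k)))) E = ennreal (lvl (Suc k) * a (Suc k) w E)"
      if "w \<in> space P" for w E
    proof -
      have "restrict (restrict w (past_upto (m k))) (past_upto (n k)) = restrict w (past_upto (n k))"
        "restrict (restrict w (past_upto (m k))) (past_upto (n (Suc k))) = restrict w (past_upto (n (Suc k)))"
        using sub[of k] by (simp_all only: restrict_restrict Int_absorb1)
      then show "ennreal (lvl k) * emeasure (K1 (restrict w (past_upto (m k)))) E = ennreal (lvl k * a k w E)"
        "ennreal (lvl (Suc k)) * emeasure (K2 (restrict w (past_upto (m k)))) E = ennreal (lvl (Suc k) * a (Suc k) w E)"
        by (simp_all only: K1_def K2_def emq[OF that] ennreal_mult a0 lvl_nonneg)
    qed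
    have le: "AE w in P. \<forall>E\<in>sets A. ennreal (lvl k) * emeasure (K1 (restrict w (past_upto (m k)))) E
       \<le> ennreal (lvl (Suc k)) * emeasure (K2 (restrict w (past_upto (m k)))) E"
      using bd AE_space
    proof eventually_elim
      case (elim w)
      show ?case
      proof
        fix E assume "E \<in> sets A"
        with elim(1) have "lvl k * a k w E \<le> lvl (Suc k) * a (Suc k) w E"
          by (intro lvl_mult_le_Suc[where x = "x w E"] a0) auto
        then show "ennreal (lvl k) * emeasure (K1 (restrict w (past_upto (m k)))) E
            \<le> ennreal (lvl (Suc k)) * emeasure (K2 (restrict w (past_upto (m k)))) E"
          by (simp add: KE[OF elim(2)] ennreal_leI)
      qed
    qed
    obtain K where
      "K \<in> ?B (past_upto (m k)) \<rightarrow>\<^sub>M prob_algebra A"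
      and 1: "\<forall>E\<in>sets A. AE w in P. ennreal (lvl (Suc k) - lvl k) * emeasure (K (restrict w (past_upto (m k)))) E +
        ennreal (lvl k) * emeasure (K1 (restrict w (past_upto (m k)))) E = ennreal (lvl (Suc k)) * emeasure (K2 (restrict w (past_upto (m k)))) E"
      and 2: "AE w in P. \<forall>E\<in>sets A.
      ennreal (lvl (Suc k) - lvl k) * emeasure (K (restrict w (past_upto (m k)))) E \<le> ennreal (lvl (Suc k)) * emeasure (K2 (restrict w (past_upto (m k)))) E"
      by (rule kernel_difference[where Y = "\<lambda>w. restrict w (past_upto (m k))", OF P resP K lvl_nonneg lvl_less_Suc le])
    moreover have "AE w in P. ennreal (p k) * emeasure (K (restrict w (past_upto (m k)))) E +
        ennreal (lvl k * a k w E) = ennreal (lvl (Suc k) * a (Suc k) w E)" if "E \<in> sets A" for E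
      using bspec[OF 1 that] AE_space by eventually_elim (simp add: KE p_def)
    moreover have "AE w in P. \<forall>E\<in>sets A.
      ennreal (p k) * emeasure (K (restrict w (past_upto (m k)))) E \<le> ennreal (lvl (Suc k) * a (Suc k) w E)"
      using 2 AE_space by eventually_elim (simp add: KE p_def)
    ultimately show "\<exists>K. K \<in> ?B (past_upto (m k)) \<rightarrow>\<^sub>M prob_algebra A \<and>
    (\<forall>E\<in>sets A. AE w in P. ennreal (p k) * emeasure (K (restrict w (past_upto (m k)))) E +
        ennreal (lvl k * a k w E) = ennreal (lvl (Suc k) * a (Suc k) w E)) \<and>
    (AE w in P. \<forall>E\<in>sets A.
      ennreal (p k) * emeasure (K (restrict w (past_upto (m k)))) E \<le> ennreal (lvl (Suc k) * a (Suc k) w E))"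
      by (intro exI[of _ K] conjI ballI)
  qed
  from choice[OF this] obtain \<mu> where \<mu>: "\<And>k. \<mu> k \<in> ?B (past_upto (m k)) \<rightarrow>\<^sub>M prob_algebra A"
    and \<mu>E: "\<And>k. \<forall>E\<in>sets A. AE w in P. ennreal (p k) * emeasure (\<mu> k (restrict w (past_upto (m k)))) E +
        ennreal (lvl k * a k w E) = ennreal (lvl (Suc k) * a (Suc k) w E)"
    and \<mu>le: "\<And>k. AE w in P. \<forall>E\<in>sets A.
      ennreal (p k) * emeasure (\<mu> k (restrict w (past_upto (m k)))) E \<le> ennreal (lvl (Suc k) * a (Suc k) w E)"
    by (auto simp only:)
  have mp: "past_upto k \<subseteq> past" for k by auto
  have rr: "restrict (restrict w past) (past_upto k) = restrict w (past_upto k)" for w :: "int \<Rightarrow> 'a" and k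
    using mp by (simp add: Int_absorb1)
  define \<mu>' where "\<mu>' k y = \<mu> k (restrict y (past_upto (m k)))" for k y
  have \<mu>'[measurable]: "\<mu>' k \<in> ?B past \<rightarrow>\<^sub>M subprob_algebra A" for k
    unfolding \<mu>'_def by (rule measurable_compose[OF res[OF mp] measurable_prob_algebraD[OF \<mu>]])
  have \<mu>'r: "\<mu>' k (restrict w past) = \<mu> k (restrict w (past_upto (m k)))" for k w
    unfolding \<mu>'_def rr ..
  \<comment> \<open>The increment is at most the weighted kernel of level \<open>Suc k\<close>,
    which in turn is at most \<open>\<kappa>\<close>; both comparisons hold off one null set for all
    \<open>E\<close>. Lifting \<open>\<mu> k\<close> to \<open>\<mu>' k\<close> puts both kernels on
    the infinite past.\<close>
  have dom: "AE w in P. \<forall>E\<in>sets A. ennreal (p k) * emeasure (\<mu>' k (restrict w past)) E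
      \<le> ennreal 1 * emeasure (\<kappa> (restrict w past)) E" for k
    using \<mu>le[of k] bd AE_space
  proof eventually_elim
    case (elim w)
    show ?case
    proof
      fix E assume E: "E \<in> sets A"
      have "ennreal (p k) * emeasure (\<mu>' k (restrict w past)) E \<le> ennreal (lvl (Suc k) * a (Suc k) w E)"
        using elim(1) E by (simp add: \<mu>'r)
      also have "\<dots> \<le> ennreal (x w E)"
        using elim(2) E by (intro ennreal_leI lvl_mult_le a0) auto
      finally show "ennreal (p k) * emeasure (\<mu>' k (restrict w past)) E
          \<le> ennreal 1 * emeasure (\<kappa> (restrict w past)) E"
        by (simp add: em\<kappa>[OF elim(3)])
    qed
  qed
  have "\<forall>k. \<exists>h. h \<in> borel_measurable (?B past \<Otimes>\<^sub>M A) \<and>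
    (\<forall>E\<in>sets A. AE w in P. ennreal (p k) * emeasure (\<mu>' k (restrict w past)) E =
        (\<integral>\<^sup>+x. h (restrict w past, x) * indicator E x \<partial>\<kappa> (restrict w past)))" 
  proof
    fix k
    obtain h where "h \<in> borel_measurable (?B past \<Otimes>\<^sub>M A)" "\<forall>z. h z \<le> 1"
      "\<forall>E\<in>sets A. AE w in P. ennreal (p k) * emeasure (\<mu>' k (restrict w past)) E =
        ennreal 1 * (\<integral>\<^sup>+x. h (restrict w past, x) * indicator E x \<partial>\<kappa> (restrict w past))"
      by (rule density_of_dominated_kernel[where Y = "\<lambda>w. restrict w past", OF P resP \<mu>' \<kappa>' dom])
    then show "\<exists>h. h \<in> borel_measurable (?B past \<Otimes>\<^sub>M A) \<and>
    (\<forall>E\<in>sets A. AE w in P. ennreal (p k) * emeasure (\<mu>' k (restrict w past)) E =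
        (\<integral>\<^sup>+x. h (restrict w past, x) * indicator E x \<partial>\<kappa> (restrict w past)))"
      by (intro exI[of _ h]) simp
  qed
  from choice[OF this] obtain g where g[measurable]: "\<And>k. g k \<in> borel_measurable (?B past \<Otimes>\<^sub>M A)"
    and gE: "\<And>k. \<forall>E\<in>sets A. AE w in P. ennreal (p k) * emeasure (\<mu>' k (restrict w past)) E =
        (\<integral>\<^sup>+x. g k (restrict w past, x) * indicator E x \<partial>\<kappa> (restrict w past))"
    by (auto simp only:)
  have X0[measurable]: "(\<lambda>w. w 0) \<in> P \<rightarrow>\<^sub>M A" by measurable
  have "random_step_data A P m p \<mu> g"
  proof (rule random_step_data.intro[OF stat m p \<mu> g])
    show "AE w in P. (\<Sum>k. g k (restrict w past, w 0)) = 1"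
    proof (rule suminf_densities_eq_1[OF P resP X0 rcd g])
      fix E assume E: "E \<in> sets A"
      have "AE w in P. \<forall>k. ennreal (p k) * emeasure (\<mu>' k (restrict w past)) E =
        (\<integral>\<^sup>+x. g k (restrict w past, x) * indicator E x \<partial>\<kappa> (restrict w past))"
        using bspec[OF gE E] by (simp add: AE_all_countable)
      moreover have "AE w in P. \<forall>k. ennreal (p k) * emeasure (\<mu>' k (restrict w past)) E +
        ennreal (lvl k * a k w E) = ennreal (lvl (Suc k) * a (Suc k) w E)"
        using bspec[OF \<mu>E E] by (simp add: AE_all_countable \<mu>'r)
      ultimately show "AE w in P. (\<Sum>k. \<integral>\<^sup>+x. g k (restrict w past, x) * indicator E x \<partial>\<kappa> (restrict w past)) =
         emeasure (\<kappa> (restrict w past)) E"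
        using bd AE_space
      proof eventually_elim
        case (elim w)
        \<comment> \<open>The increments telescope, and \<open>lvl 0 = 0\<close> leaves no term at
          the start; in the limit the full conditional law is recovered.\<close>
        have "(\<Sum>k<N. ennreal (p k) * emeasure (\<mu>' k (restrict w past)) E) = ennreal (lvl N * a N w E)" for N
        proof (induction N)
          case (Suc N)
          show ?case
            unfolding sum.lessThan_Suc Suc by (subst add.commute) (rule spec[OF elim(2)])
        qed (simp add: lvl_def)
        moreover have "(\<lambda>N. ennreal (lvl N * a N w E)) \<longlonglongrightarrow> ennreal (x w E)"
          using elim(3) E by (intro tendsto_ennrealI lvl_mult_tendsto a0) auto
        ultimately have "(\<lambda>k. ennreal (p k) * emeasure (\<mu>' k (restrict w past)) E) sums ennreal (x w E)"
          by (simp add: sums_def)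
        then show ?case
          using elim(1) by (simp add: em\<kappa>[OF elim(4)] sums_iff)
      qed
    qed
  next
    fix k :: nat and \<phi> :: "(int \<Rightarrow> 'a) \<Rightarrow> ennreal" and E
    assume \<phi>[measurable]: "\<phi> \<in> borel_measurable (?B past)" and E[measurable]: "E \<in> sets A"
    \<comment> \<open>Disintegration replaces the value at time 0 by an integral against
      \<open>\<kappa>\<close>, where \<open>g k\<close> acts as the density of \<open>p k\<close>
      times \<open>\<mu>' k\<close>.\<close>
    have "(\<integral>\<^sup>+w. \<phi> (restrict w past) * indicator E (w 0) * g k (restrict w past, w 0) \<partial>P) =
       (\<integral>\<^sup>+w. \<integral>\<^sup>+x. \<phi> (restrict w past) * indicator E x * g k (restrict w past, x) \<partial>\<kappa> (restrict w past) \<partial>P)"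
      using regular_cond_dist_nn_integral[OF P resP X0 rcd, of "\<lambda>(y, x). \<phi> y * indicator E x * g k (y, x)"]
      by simp
    also have "\<dots> = (\<integral>\<^sup>+w. ennreal (p k) * (\<phi> (restrict w past) * emeasure (\<mu>' k (restrict w past)) E) \<partial>P)"
    proof (rule nn_integral_cong_AE)
      show "AE w in P. (\<integral>\<^sup>+x. \<phi> (restrict w past) * indicator E x * g k (restrict w past, x) \<partial>\<kappa> (restrict w past)) =
         ennreal (p k) * (\<phi> (restrict w past) * emeasure (\<mu>' k (restrict w past)) E)"
        using bspec[OF gE E, of k] AE_space
      proof eventually_elim
        case (elim w)
        have y[simp]: "restrict w past \<in> space (?B past)"
          by (rule measurable_space[OF _ elim(2)]) measurable
        have meas: "(\<lambda>x. g k (restrict w past, x) * indicator E x) \<in> borel_measurable (\<kappa> (restrict w past))"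
          unfolding measurable_cong_sets[OF sets_kernel[OF \<kappa>' y] refl]
          by (intro borel_measurable_times_ennreal measurable_compose[OF measurable_Pair1'[OF y] g]
              borel_measurable_indicator E)
        have "(\<integral>\<^sup>+x. \<phi> (restrict w past) * indicator E x * g k (restrict w past, x) \<partial>\<kappa> (restrict w past)) =
           (\<integral>\<^sup>+x. \<phi> (restrict w past) * (g k (restrict w past, x) * indicator E x) \<partial>\<kappa> (restrict w past))"
          by (intro nn_integral_cong) (simp add: mult_ac)
        also have "\<dots> = \<phi> (restrict w past) * (\<integral>\<^sup>+x. g k (restrict w past, x) * indicator E x \<partial>\<kappa> (restrict w past))"
          by (rule nn_integral_cmult[OF meas])
        finally show ?case unfolding elim(1)[symmetric] by (simp add: mult_ac)
      qed
    qed
    also have "\<dots> = ennreal (p k) * (\<integral>\<^sup>+w. \<phi> (restrict w past) * emeasure (\<mu>' k (restrict w past)) E \<partial>P)"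
      by (rule nn_integral_cmult) measurable
    finally show "(\<integral>\<^sup>+w. \<phi> (restrict w past) * indicator E (w 0) * g k (restrict w past, w 0) \<partial>P) =
      ennreal (p k) * (\<integral>\<^sup>+w. \<phi> (restrict w past) *
        emeasure (\<mu> k (restrict w (past_upto (m k)))) E \<partial>P)"
      by (simp add: \<mu>'r)
  qed
  then show ?thesis by blast
qed

subsection \<open>The coupling\<close>

definition unif :: "real measure" where
  "unif = uniform_measure lborel {0..<1}"

lemma prob_space_unif: "prob_space unif"
  unfolding unif_def by (rule prob_space_uniform_measure) auto

lemma sets_unif[measurable_cong]: "sets unif = sets borel" and space_unif[simp]: "space unif = UNIV"
  by (simp_all add: unif_def)

text \<open>Inversion sampling: the partial sums of a probability sequence \<open>f\<close> cut the
  unit interval into half-open pieces of length \<open>f k\<close>, and \<open>u\<close> selects the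
  piece containing it.\<close>

definition first_above :: "(nat \<Rightarrow> ennreal) \<Rightarrow> real \<Rightarrow> nat" where
  "first_above f u = (LEAST k. ennreal u < (\<Sum>j<Suc k. f j))"

lemma emeasure_first_above:
  assumes "(\<Sum>j. f j) = 1"
  shows "emeasure unif {u. first_above f u = k} = f k"
proof -
  define S where "S k = (\<Sum>j<k. f j)" for k
  have S_mono: "S i \<le> S j" if "i \<le> j" for i j
    unfolding S_def using that by (intro sum_mono2) auto
  have S1: "S k \<le> 1" for k
    unfolding S_def assms[symmetric] by (rule sum_le_suminf) auto
  have lim: "S \<longlonglongrightarrow> 1"
    using summable_LIMSEQ[of f] assms unfolding S_def[abs_def] by simp
  \<comment> \<open>The partial sums are at most 1, hence finite, and move to the reals, where they
    become the endpoints of intervals.\<close>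
  define r where "r k = enn2real (S k)" for k
  have r: "ennreal (r k) = S k" for k
    unfolding r_def using S1[of k] by (intro ennreal_enn2real) (auto simp: less_top[symmetric] top_unique)
  have r0: "0 \<le> r k" for k by (simp add: r_def)
  have r1: "r k \<le> 1" for k using S1[of k] unfolding r[symmetric] by simp
  have r_mono: "r i \<le> r j" if "i \<le> j" for i j
    using S_mono[OF that] r0 by (simp add: r[symmetric])
  have iff: "first_above f u = k \<longleftrightarrow> r k \<le> u \<and> u < r (Suc k)" if u: "0 \<le> u" "u < 1" for u
  proof -
    have lt: "ennreal u < (\<Sum>j<Suc i. f j) \<longleftrightarrow> u < r (Suc i)" for i
      unfolding S_def[symmetric] r[symmetric] using u r0 by (simp add: ennreal_less_iff)
    \<comment> \<open>A witness for \<open>LEAST\<close>: the partial sums tend to 1, which exceeds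
      \<open>u\<close>.\<close>
    have "eventually (\<lambda>k. ennreal u < S k) sequentially"
      using u by (intro order_tendstoD(1)[OF lim]) simp
    then obtain N where "ennreal u < S N" by (auto simp: eventually_sequentially)
    then have "u < r N" using u by (simp add: r[symmetric] ennreal_less_iff)
    then have ex: "u < r (Suc N)" using r_mono[of N "Suc N"] by simp
    have eq: "first_above f u = (LEAST i. u < r (Suc i))"
      unfolding first_above_def lt ..
    show ?thesis
    proof
      assume k: "first_above f u = k"
      have "u < r (Suc k)" unfolding k[symmetric] eq using ex by (rule LeastI)
      moreover have "r k \<le> u"
      proof (cases k)
        case 0 then show ?thesis using u by (simp add: r_def S_def)
      next
        case (Suc i)
        then have "\<not> u < r (Suc i)" using k unfolding eq by (intro not_less_Least) simp
        then show ?thesis using Suc by simp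
      qed
      ultimately show "r k \<le> u \<and> u < r (Suc k)" by simp
    next
      assume k: "r k \<le> u \<and> u < r (Suc k)"
      show "first_above f u = k"
        unfolding eq
      proof (rule Least_equality)
        fix i assume "u < r (Suc i)"
        show "k \<le> i"
        proof (rule ccontr)
          assume "\<not> k \<le> i"
          then have "r (Suc i) \<le> r k" by (intro r_mono) simp
          with k \<open>u < r (Suc i)\<close> show False by simp
        qed
      qed (use k in simp)
    qed
  qed
  have set_eq: "{0..<1} \<inter> {u. first_above f u = k} = {r k..<r (Suc k)}"
    using iff r0[of k] r1[of "Suc k"] by (auto; smt (verit, best))
  have meas: "{u. first_above f u = k} \<in> sets borel"
  proof -
    have "{u \<in> space borel. first_above f u = k} \<in> sets borel"
      unfolding first_above_def by measurable
    then show ?thesis by simp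
  qed
  then have "emeasure unif {u. first_above f u = k} = emeasure lborel {r k..<r (Suc k)}"
    unfolding unif_def by (subst emeasure_uniform_measure) (auto simp: set_eq divide_ennreal_def)
  also have "\<dots> = ennreal (r (Suc k)) - ennreal (r k)"
    using r_mono[of k "Suc k"] r0 by (simp add: ennreal_minus)
  also have "\<dots> = f k"
    unfolding r by (simp add: S_def r[unfolded S_def, symmetric])
  finally show ?thesis .
qed

section \<open>Stationarity and the past seen from an arbitrary time\<close>

context random_step_data
begin

sublocale P: prob_space P
  using stationary by (simp add: stationary_process_def)

abbreviation "B \<equiv> Pi\<^sub>M past (\<lambda>_. A)"

lemma sets_P[measurable_cong]: "sets P = sets (Pi\<^sub>M UNIV (\<lambda>_. A))"
  using stationary by (simp add: stationary_process_def seq_space_def)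

lemma space_P: "space P = space (Pi\<^sub>M UNIV (\<lambda>_. A))"
  by (rule sets_eq_imp_space_eq[OF sets_P])

lemma restrict_P[measurable]: "(\<lambda>w. restrict w I) \<in> P \<rightarrow>\<^sub>M Pi\<^sub>M I (\<lambda>_. A)"
  unfolding measurable_cong_sets[OF sets_P refl] by (rule measurable_restrict_subset) simp

lemma shift_measurable: "(\<lambda>w i. w (i + d)) \<in> P \<rightarrow>\<^sub>M Pi\<^sub>M UNIV (\<lambda>_::int. A)" for d :: int
  unfolding measurable_cong_sets[OF sets_P refl]
  by (intro measurable_abs_UNIV measurable_component_singleton) simp

lemma nn_integral_shift:
  assumes "f \<in> borel_measurable P"
  shows "(\<integral>\<^sup>+w. f (\<lambda>i. w (i + d)) \<partial>P) = (\<integral>\<^sup>+w. f w \<partial>P)"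
proof -
  have shm: "(\<lambda>w i. w (i + d)) \<in> P \<rightarrow>\<^sub>M P" for d :: int
    unfolding measurable_cong_sets[OF refl sets_P] by (rule shift_measurable)
  have one: "(\<integral>\<^sup>+w. f (\<lambda>i. w (i + 1)) \<partial>P) = (\<integral>\<^sup>+w. f w \<partial>P)" if "f \<in> borel_measurable P" for f
  proof -
    have "distr P P (\<lambda>w i. w (i + 1)) = P"
      using stationary by (simp add: stationary_process_def cong: distr_cong)
    then have "(\<integral>\<^sup>+w. f w \<partial>P) = (\<integral>\<^sup>+w. f w \<partial>distr P P (\<lambda>w i. w (i + 1)))" by simp
    also have "\<dots> = (\<integral>\<^sup>+w. f (\<lambda>i. w (i + 1)) \<partial>P)"
      by (rule nn_integral_distr[OF shm]) (simp add: that)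
    finally show ?thesis ..
  qed
  have nat: "(\<integral>\<^sup>+w. f (\<lambda>i. w (i + int n)) \<partial>P) = (\<integral>\<^sup>+w. f w \<partial>P)" if "f \<in> borel_measurable P" for f n
  proof (induction n)
    case (Suc n)
    have "(\<lambda>w. f (\<lambda>i. w (i + int n))) \<in> borel_measurable P"
      by (rule measurable_compose[OF shm that])
    from one[OF this] Suc show ?case by (simp add: algebra_simps)
  qed simp
  show ?thesis
  proof (cases "0 \<le> d")
    case True
    then show ?thesis using nat[OF assms, of "nat d"] by simp
  next
    case False
    \<comment> \<open>For negative \<open>d\<close>, invariance under the forward shift by
      \<open>- d\<close> is applied to the function already shifted by \<open>d\<close>.\<close>
    have "(\<lambda>w. f (\<lambda>i. w (i + d))) \<in> borel_measurable P"
      by (rule measurable_compose[OF shm assms])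
    from nat[OF this, of "nat (- d)"] False show ?thesis by simp
  qed
qed

text \<open>The past of time \<open>i\<close> is re-indexed by the negative integers, so that the
  same densities \<open>g k\<close> apply at every time.\<close>

definition view :: "int \<Rightarrow> (int \<Rightarrow> 'a) \<Rightarrow> (int \<Rightarrow> 'a) \<times> 'a" where
  "view i w = (\<lambda>j\<in>past. w (j + i), w i)"

lemma view_0: "view 0 w = (restrict w past, w 0)"
  by (simp add: view_def)

lemma view_shift: "view i (\<lambda>j. w (j + d)) = view (i + d) w"
  by (simp add: view_def add.assoc)

lemma view_restrict: "i < 0 \<Longrightarrow> view i (restrict w past) = view i w"
  by (auto simp: view_def fun_eq_iff)

lemma view_measurable[measurable]: "view i \<in> P \<rightarrow>\<^sub>M B \<Otimes>\<^sub>M A"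
  unfolding view_def[abs_def] by measurable

lemma view_measurable_past: "i < 0 \<Longrightarrow> view i \<in> B \<rightarrow>\<^sub>M B \<Otimes>\<^sub>M A"
  unfolding view_def[abs_def]
  by (intro measurable_Pair measurable_restrict measurable_component_singleton) auto

text \<open>With \<open>u\<close> uniform on \<open>[0, 1)\<close>, the step is \<open>m k\<close> with probability \<open>g k b\<close>, provided that
  these sum to 1 (on the null set where they do not, the value may be junk).\<close>

definition step :: "(int \<Rightarrow> 'a) \<times> 'a \<Rightarrow> real \<Rightarrow> nat" where
  "step b u = m (first_above (\<lambda>k. g k b) u)"

lemma step_pos: "1 \<le> step b u"
proof -
  have "m 0 \<le> step b u" unfolding step_def using m(1) by (simp add: strict_mono_less_eq)
  with m(2) show ?thesis by linarith
qed

lemma step_measurable[measurable]: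
  assumes [measurable]: "b \<in> M \<rightarrow>\<^sub>M B \<Otimes>\<^sub>M A" "u \<in> borel_measurable M"
  shows "(\<lambda>x. step (b x) (u x)) \<in> M \<rightarrow>\<^sub>M count_space UNIV"
  unfolding step_def first_above_def by measurable

lemma step_measurable_pos[measurable]:
  assumes "b \<in> M \<rightarrow>\<^sub>M B \<Otimes>\<^sub>M A" "u \<in> borel_measurable M"
  shows "(\<lambda>x. step (b x) (u x)) \<in> M \<rightarrow>\<^sub>M pos_nat_space"
  unfolding pos_nat_space_def
  using step_pos step_measurable[OF assms] by (auto simp: measurable_def)

definition step_prob :: "nat set \<Rightarrow> (int \<Rightarrow> 'a) \<times> 'a \<Rightarrow> ennreal" where
  "step_prob F b = emeasure unif {u. step b u \<in> F}"

text \<open>Each \<open>u\<close> selects exactly one index, so the event splits into disjoint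
  pieces, the piece of index \<open>k\<close> having mass \<open>g k b\<close>.\<close>

lemma step_prob_eq:
  assumes b: "b \<in> space (B \<Otimes>\<^sub>M A)" and "(\<Sum>k. g k b) = 1"
  shows "step_prob F b = (\<Sum>k. indicator F (m k) * g k b)"
proof -
  let ?K = "first_above (\<lambda>k. g k b)"
  have Km[measurable]: "?K \<in> borel \<rightarrow>\<^sub>M count_space UNIV"
    unfolding first_above_def by measurable
  have Ks: "{u. ?K u = k} \<in> sets unif" for k
    using measurable_sets[OF Km, of "{k}"] by (simp add: vimage_def sets_unif)
  have "step_prob F b = (\<integral>\<^sup>+u. indicator {u. step b u \<in> F} u \<partial>unif)"
    unfolding step_prob_def
    using measurable_sets[OF Km, of "m -` F"] by (simp add: step_def vimage_def sets_unif)
  also have "\<dots> = (\<integral>\<^sup>+u. (\<Sum>k. indicator F (m k) * indicator {u. ?K u = k} u) \<partial>unif)"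
  proof (intro nn_integral_cong)
    fix u
    have "(\<Sum>k. indicator F (m k) * indicator {u. ?K u = k} u :: ennreal) =
        (\<Sum>k\<in>{?K u}. indicator F (m k) * indicator {u. ?K u = k} u)"
      by (rule suminf_finite) auto
    then show "indicator {u. step b u \<in> F} u = (\<Sum>k. indicator F (m k) * indicator {u. ?K u = k} u :: ennreal)"
      by (simp add: step_def indicator_def)
  qed
  also have "\<dots> = (\<Sum>k. \<integral>\<^sup>+u. indicator F (m k) * indicator {u. ?K u = k} u \<partial>unif)"
    by (rule nn_integral_suminf) (use Ks in measurable)
  also have "\<dots> = (\<Sum>k. indicator F (m k) * g k b)"
    by (intro suminf_cong) (simp add: nn_integral_cmult Ks emeasure_first_above[OF assms(2)])
  finally show ?thesis .
qed

lemma step_prob_measurable[measurable]: "step_prob F \<in> borel_measurable (B \<Otimes>\<^sub>M A)"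
proof -
  interpret U: prob_space unif by (rule prob_space_unif)
  have "{z \<in> space ((B \<Otimes>\<^sub>M A) \<Otimes>\<^sub>M unif). step (fst z) (snd z) \<in> F} \<in> sets ((B \<Otimes>\<^sub>M A) \<Otimes>\<^sub>M unif)"
    by measurable
  from U.measurable_emeasure_Pair[OF this] show ?thesis
    by (rule measurable_cong[THEN iffD1, rotated])
       (auto simp: step_prob_def space_pair_measure intro!: arg_cong2[where f=emeasure])
qed

lemma AE_step_prob: "AE w in P. \<forall>F. step_prob F (view 0 w) = (\<Sum>k. indicator F (m k) * g k (view 0 w))"
  using sum_g AE_space
proof eventually_elim
  case (elim w)
  then have "view 0 w \<in> space (B \<Otimes>\<^sub>M A)" using measurable_space[OF view_measurable] by blast
  with elim show ?case by (auto simp: view_0 intro!: step_prob_eq)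
qed

definition law :: "nat set \<Rightarrow> ennreal" where
  "law F = (\<Sum>k. indicator F (m k) * ennreal (p k))"

lemma \<mu>_space:
  assumes "w \<in> space P" shows "emeasure (\<mu> k (restrict w (past_upto (m k)))) (space A) = 1"
proof -
  have "restrict w (past_upto (m k)) \<in> space (Pi\<^sub>M (past_upto (m k)) (\<lambda>_. A))"
    by (rule measurable_space[OF restrict_P assms])
  then have "\<mu> k (restrict w (past_upto (m k))) \<in> space (prob_algebra A)"
    by (rule measurable_space[OF \<mu>])
  then have ps: "prob_space (\<mu> k (restrict w (past_upto (m k))))"
    and sets: "sets (\<mu> k (restrict w (past_upto (m k)))) = sets A"
    by (auto simp: space_prob_algebra)
  show ?thesis
    using prob_space.emeasure_space_1[OF ps] sets_eq_imp_space_eq[OF sets] by simp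
qed

text \<open>This is the independence of the step at time 0 and the past, before the coupling is
  built: \<open>g_cond\<close> with the whole alphabet as \<open>E\<close> replaces
  \<open>g k\<close> by the constant \<open>p k\<close>, because \<open>\<mu> k\<close> has mass
  1.\<close>

lemma nn_integral_past_step_prob:
  assumes \<phi>[measurable]: "\<phi> \<in> borel_measurable B"
  shows "(\<integral>\<^sup>+w. \<phi> (restrict w past) * step_prob F (view 0 w) \<partial>P) = law F * (\<integral>\<^sup>+w. \<phi> (restrict w past) \<partial>P)"
proof -
  have "(\<integral>\<^sup>+w. \<phi> (restrict w past) * step_prob F (view 0 w) \<partial>P) =
     (\<integral>\<^sup>+w. (\<Sum>k. indicator F (m k) * (\<phi> (restrict w past) * g k (view 0 w))) \<partial>P)"
    using AE_step_prob
    by (intro nn_integral_cong_AE)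
      (auto elim!: eventually_mono simp: mult.left_commute ennreal_suminf_cmult[symmetric]
        simp del: ennreal_suminf_cmult)
  also have "\<dots> = (\<Sum>k. \<integral>\<^sup>+w. indicator F (m k) * (\<phi> (restrict w past) * g k (view 0 w)) \<partial>P)"
    by (rule nn_integral_suminf) measurable
  also have "\<dots> = (\<Sum>k. indicator F (m k) * ennreal (p k) * (\<integral>\<^sup>+w. \<phi> (restrict w past) \<partial>P))"
  proof (intro suminf_cong)
    fix k
    have "(\<integral>\<^sup>+w. \<phi> (restrict w past) * g k (view 0 w) \<partial>P) =
       (\<integral>\<^sup>+w. \<phi> (restrict w past) * indicator (space A) (w 0) * g k (restrict w past, w 0) \<partial>P)"
      by (intro nn_integral_cong) (auto simp: view_0 space_P space_PiM PiE_iff)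
    also have "\<dots> = ennreal (p k) * (\<integral>\<^sup>+w. \<phi> (restrict w past) \<partial>P)"
      unfolding g_cond[OF \<phi> sets.top] using \<mu>_space
      by (intro arg_cong2[where f = "(*)"] nn_integral_cong) auto
    finally show "(\<integral>\<^sup>+w. indicator F (m k) * (\<phi> (restrict w past) * g k (view 0 w)) \<partial>P) =
       indicator F (m k) * ennreal (p k) * (\<integral>\<^sup>+w. \<phi> (restrict w past) \<partial>P)"
      by (simp add: nn_integral_cmult mult.assoc)
  qed
  also have "\<dots> = law F * (\<integral>\<^sup>+w. \<phi> (restrict w past) \<partial>P)"
    unfolding law_def by simp
  finally show ?thesis .
qed

text \<open>All factors but the one of the latest time are functions of the past of that time; shifting
  it to 0, the latest factor can be replaced by its conditional mean.\<close>

lemma nn_integral_prod_step_prob: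
  assumes "finite J"
  shows "(\<integral>\<^sup>+w. (\<Prod>j\<in>J. step_prob (F j) (view j w)) \<partial>P) = (\<Prod>j\<in>J. law (F j))"
  using assms
proof (induction J rule: finite_linorder_max_induct)
  case empty
  then show ?case by (simp add: P.emeasure_space_1)
next
  case (insert b J)
  define \<phi> where "\<phi> y = (\<Prod>j\<in>J. step_prob (F j) (view (j - b) y))" for y
  have neg: "j - b < 0" if "j \<in> J" for j using insert that by auto
  have \<phi>: "\<phi> \<in> borel_measurable B"
    unfolding \<phi>_def[abs_def]
    by (intro borel_measurable_prod_ennreal measurable_compose[OF view_measurable_past step_prob_measurable] neg)
  have \<phi>r: "\<phi> (restrict w past) = \<phi> w" for w
    unfolding \<phi>_def by (intro prod.cong refl arg_cong[where f = "step_prob _"] view_restrict neg)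
  have sh: "(\<integral>\<^sup>+w. (\<Prod>j\<in>I. step_prob (F j) (view (j - b) w)) \<partial>P) =
     (\<integral>\<^sup>+w. (\<Prod>j\<in>I. step_prob (F j) (view j w)) \<partial>P)" for I
    using nn_integral_shift[of "\<lambda>w. \<Prod>j\<in>I. step_prob (F j) (view j w)" "- b"]
    by (simp add: view_shift[of _ _ "- b", simplified])
  have "(\<integral>\<^sup>+w. (\<Prod>j\<in>insert b J. step_prob (F j) (view j w)) \<partial>P) =
      (\<integral>\<^sup>+w. (\<Prod>j\<in>insert b J. step_prob (F j) (view (j - b) w)) \<partial>P)"
    by (rule sh[symmetric])
  also have "\<dots> = (\<integral>\<^sup>+w. \<phi> (restrict w past) * step_prob (F b) (view 0 w) \<partial>P)"
    unfolding \<phi>r using insert by (intro nn_integral_cong) (auto simp: \<phi>_def mult.commute)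
  also have "\<dots> = law (F b) * (\<integral>\<^sup>+w. (\<Prod>j\<in>J. step_prob (F j) (view j w)) \<partial>P)"
    unfolding nn_integral_past_step_prob[OF \<phi>] by (simp only: \<phi>r) (simp only: \<phi>_def sh)
  also have "\<dots> = (\<Prod>j\<in>insert b J. law (F j))"
    using insert by auto
  finally show ?case .
qed

section \<open>The coupled process\<close>

abbreviation "noise \<equiv> Pi\<^sub>M UNIV (\<lambda>_::int. unif)"

abbreviation "AL \<equiv> A \<Otimes>\<^sub>M pos_nat_space"

text \<open>Each time has a uniform variable of its own, which makes the steps independent given the
  sequence. Since the step at time \<open>i\<close> sees the sequence only through
  \<open>view i\<close>, the map commutes with shifts.\<close>

definition couple :: "(int \<Rightarrow> 'a) \<times> (int \<Rightarrow> real) \<Rightarrow> int \<Rightarrow> 'a \<times> nat" where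
  "couple z i = (fst z i, step (view i (fst z)) (snd z i))"

definition Q :: "(int \<Rightarrow> 'a \<times> nat) measure" where
  "Q = distr (P \<Otimes>\<^sub>M noise) (seq_space AL) couple"

lemma prob_space_noise: "prob_space noise"
  by (rule prob_space_PiM) (rule prob_space_unif)

sublocale noise: prob_space noise
  by (rule prob_space_noise)

sublocale PN: prob_space "P \<Otimes>\<^sub>M noise"
  by (rule prob_space_pair[OF P.prob_space_axioms prob_space_noise])

lemma couple_measurable[measurable]: "couple \<in> P \<Otimes>\<^sub>M noise \<rightarrow>\<^sub>M seq_space AL"
  unfolding couple_def[abs_def] seq_space_def
  by (intro measurable_abs_UNIV measurable_Pair) measurable

lemma sets_Q[measurable_cong]: "sets Q = sets (Pi\<^sub>M UNIV (\<lambda>_. AL))"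
  by (simp add: Q_def seq_space_def)

lemma prob_space_Q: "prob_space Q"
  unfolding Q_def by (rule PN.prob_space_distr) measurable

sublocale Q: prob_space Q
  by (rule prob_space_Q)

lemma component_Q: "(\<lambda>x. x i) \<in> Q \<rightarrow>\<^sub>M AL"
  unfolding measurable_cong_sets[OF sets_Q refl]
  using measurable_component_singleton[of i UNIV "\<lambda>_. AL"] by simp

lemma fst_component_Q[measurable]: "(\<lambda>x. fst (x i)) \<in> Q \<rightarrow>\<^sub>M A"
  by (rule measurable_compose[OF component_Q measurable_fst])

lemma fst_Q[measurable]: "(\<lambda>x i. fst (x i)) \<in> Q \<rightarrow>\<^sub>M Pi\<^sub>M UNIV (\<lambda>_. A)"
  by (intro measurable_abs_UNIV fst_component_Q)

lemma snd_Q[measurable]: "(\<lambda>x. snd (x i)) \<in> Q \<rightarrow>\<^sub>M pos_nat_space"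
  by (rule measurable_compose[OF component_Q measurable_snd])

lemma emeasure_noise_cylinder:
  assumes "finite J" "\<And>j. j \<in> J \<Longrightarrow> V j \<in> sets borel"
  shows "(\<integral>\<^sup>+u. (\<Prod>j\<in>J. indicator (V j) (u j)) \<partial>noise) = (\<Prod>j\<in>J. emeasure unif (V j))"
proof -
  have V: "V j \<in> sets unif" if "j \<in> J" for j using assms that by (simp add: sets_unif)
  let ?C = "prod_emb UNIV (\<lambda>_. unif) J (Pi\<^sub>E J V)"
  have C: "?C \<in> sets noise" using V assms(1) by (intro sets_PiM_I) auto
  have "(\<integral>\<^sup>+u. (\<Prod>j\<in>J. indicator (V j) (u j)) \<partial>noise) = (\<integral>\<^sup>+u. indicator ?C u \<partial>noise)"
    using assms(1) by (intro nn_integral_cong)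
      (auto simp: prod_emb_def space_PiM PiE_iff indicator_def)
  also have "\<dots> = (\<Prod>j\<in>J. emeasure unif (V j))"
    using C V assms(1) by (simp add: emeasure_PiM_emb prob_space_unif)
  finally show ?thesis .
qed

text \<open>Fubini with the noise integrated first: for fixed \<open>w\<close> the factors involve
  distinct noise coordinates, so their mean is a product of values of \<open>step_prob\<close>. The
  independence and conditioning claims below rest on this formula.\<close>

lemma nn_integral_Q:
  assumes J: "finite J" and F: "\<And>j. j \<in> J \<Longrightarrow> F j \<in> sets pos_nat_space"
    and \<phi>[measurable]: "\<phi> \<in> borel_measurable P"
  shows "(\<integral>\<^sup>+x. \<phi> (\<lambda>i. fst (x i)) * (\<Prod>j\<in>J. indicator (F j) (snd (x j))) \<partial>Q) =
    (\<integral>\<^sup>+w. \<phi> w * (\<Prod>j\<in>J. step_prob (F j) (view j w)) \<partial>P)"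
proof -
  have \<phi>': "(\<lambda>x. \<phi> (\<lambda>i. fst (x i))) \<in> borel_measurable Q"
    by (rule measurable_compose[OF fst_Q]) (simp add: measurable_cong_sets[OF sets_P[symmetric] refl])
  have i: "(\<lambda>x. indicator (F j) (snd (x j)) :: ennreal) \<in> borel_measurable Q" if "j \<in> J" for j
    by (rule measurable_compose[OF snd_Q borel_measurable_indicator[OF F[OF that]]])
  have "(\<lambda>x. \<phi> (\<lambda>i. fst (x i)) * (\<Prod>j\<in>J. indicator (F j) (snd (x j)))) \<in> borel_measurable (seq_space AL)"
    using \<phi>' i by (intro borel_measurable_times_ennreal borel_measurable_prod_ennreal)
      (simp_all add: measurable_cong_sets[OF sets_Q refl] seq_space_def)
  then have "(\<integral>\<^sup>+x. \<phi> (\<lambda>i. fst (x i)) * (\<Prod>j\<in>J. indicator (F j) (snd (x j))) \<partial>Q) =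
      (\<integral>\<^sup>+z. \<phi> (fst z) * (\<Prod>j\<in>J. indicator (F j) (step (view j (fst z)) (snd z j))) \<partial>(P \<Otimes>\<^sub>M noise))"
    unfolding Q_def by (subst nn_integral_distr) (simp_all add: couple_def)
  also have "\<dots> = (\<integral>\<^sup>+w. \<integral>\<^sup>+u. \<phi> w * (\<Prod>j\<in>J. indicator (F j) (step (view j w) (u j))) \<partial>noise \<partial>P)"
  proof (subst noise.nn_integral_fst[symmetric])
    have "(\<lambda>z. indicator (F j) (step (view j (fst z)) (snd z j)) :: ennreal) \<in> borel_measurable (P \<Otimes>\<^sub>M noise)"
      if "j \<in> J" for j
    proof (rule measurable_compose[OF _ borel_measurable_indicator[OF F[OF that]]])
      show "(\<lambda>z. step (view j (fst z)) (snd z j)) \<in> P \<Otimes>\<^sub>M noise \<rightarrow>\<^sub>M pos_nat_space"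
        by measurable
    qed
    then show "(\<lambda>z. \<phi> (fst z) * (\<Prod>j\<in>J. indicator (F j) (step (view j (fst z)) (snd z j))))
        \<in> borel_measurable (P \<Otimes>\<^sub>M noise)"
      by (intro borel_measurable_times_ennreal borel_measurable_prod_ennreal) auto
  qed simp
  also have "\<dots> = (\<integral>\<^sup>+w. \<phi> w * (\<Prod>j\<in>J. step_prob (F j) (view j w)) \<partial>P)"
  proof (intro nn_integral_cong)
    fix w assume w: "w \<in> space P"
    have V: "{u. step (view j w) u \<in> F j} \<in> sets borel" for j
    proof -
      have "view j w \<in> space (B \<Otimes>\<^sub>M A)" by (rule measurable_space[OF view_measurable w])
      then have "step (view j w) \<in> borel \<rightarrow>\<^sub>M count_space UNIV" by measurable
      from measurable_sets[OF this, of "F j"] show ?thesis by (simp add: vimage_def)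
    qed
    have m: "(\<lambda>u. \<Prod>j\<in>J. indicator {u. step (view j w) u \<in> F j} (u j) :: ennreal) \<in> borel_measurable noise"
      using V by (intro borel_measurable_prod_ennreal
          measurable_compose[OF measurable_component_singleton borel_measurable_indicator])
        (auto simp: sets_unif)
    have "(\<integral>\<^sup>+u. \<phi> w * (\<Prod>j\<in>J. indicator (F j) (step (view j w) (u j))) \<partial>noise) =
        (\<integral>\<^sup>+u. \<phi> w * (\<Prod>j\<in>J. indicator {u. step (view j w) u \<in> F j} (u j)) \<partial>noise)"
      by (simp add: indicator_def)
    also have "\<dots> = \<phi> w * (\<integral>\<^sup>+u. (\<Prod>j\<in>J. indicator {u. step (view j w) u \<in> F j} (u j)) \<partial>noise)"
      by (rule nn_integral_cmult[OF m])
    also have "\<dots> = \<phi> w * (\<Prod>j\<in>J. step_prob (F j) (view j w))"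
      using V J by (simp add: emeasure_noise_cylinder step_prob_def)
    finally show "(\<integral>\<^sup>+u. \<phi> w * (\<Prod>j\<in>J. indicator (F j) (step (view j w) (u j))) \<partial>noise) =
      \<phi> w * (\<Prod>j\<in>J. step_prob (F j) (view j w))" .
  qed
  finally show ?thesis .
qed

lemma nn_integral_Q_0:
  assumes F: "F \<in> sets pos_nat_space" and \<phi>: "\<phi> \<in> borel_measurable P"
  shows "(\<integral>\<^sup>+x. \<phi> (\<lambda>i. fst (x i)) * indicator F (snd (x 0)) \<partial>Q) =
    (\<integral>\<^sup>+w. \<phi> w * step_prob F (view 0 w) \<partial>P)"
  using nn_integral_Q[of "{0}" "\<lambda>_. F" \<phi>] assms by simp

lemma nn_integral_Q_past:
  assumes F: "F \<in> sets pos_nat_space" and \<phi>[measurable]: "\<phi> \<in> borel_measurable B"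
  shows "(\<integral>\<^sup>+x. \<phi> (\<lambda>i\<in>past. fst (x i)) * indicator F (snd (x 0)) \<partial>Q) =
    law F * (\<integral>\<^sup>+w. \<phi> (restrict w past) \<partial>P)"
  using nn_integral_Q_0[OF F, of "\<lambda>w. \<phi> (restrict w past)"] nn_integral_past_step_prob[OF \<phi>, of F]
  by simp

text \<open>That the weights \<open>p k\<close> add up to 1 is not among the data of the locale. It
  is read off from the coupling, a probability measure under which all steps are positive.\<close>

lemma law_space: "law {1..} = 1"
proof -
  have "law {1..} = (\<integral>\<^sup>+x. 1 * indicator {1..} (snd (x 0)) \<partial>Q)"
    using nn_integral_Q_past[of "{1..}" "\<lambda>_. 1"] by (simp add: pos_nat_space_def P.emeasure_space_1)
  also have "\<dots> = (\<integral>\<^sup>+x. 1 \<partial>Q)"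
    using measurable_space[OF snd_Q] by (intro nn_integral_cong) (auto simp: pos_nat_space_def)
  finally show ?thesis by (simp add: Q.emeasure_space_1)
qed

lemma distr_shift_noise: "distr noise noise (\<lambda>u i. u (i + 1)) = noise"
  using distr_PiM_reindex[of UNIV "\<lambda>_. unif" "\<lambda>i::int. i + 1" UNIV] prob_space_unif
  by (simp add: restrict_UNIV)

text \<open>Both factors of the source space are shift invariant, and \<open>couple\<close>
  intertwines their simultaneous shift with the shift of pairs.\<close>

lemma stationary_Q: "stationary_process AL Q"
  unfolding stationary_process_def
proof (intro conjI prob_space_Q)
  show "sets Q = sets (seq_space AL)" by (simp add: Q_def)
  have PP: "distr P P (\<lambda>w i. w (i + 1)) = P"
    using stationary by (simp add: stationary_process_def cong: distr_cong)
  have shP: "(\<lambda>w i. w (i + 1)) \<in> P \<rightarrow>\<^sub>M P"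
    unfolding measurable_cong_sets[OF refl sets_P] by (rule shift_measurable)
  have shN: "(\<lambda>u i. u (i + 1)) \<in> noise \<rightarrow>\<^sub>M noise"
    by (intro measurable_abs_UNIV measurable_component_singleton) simp
  let ?sh = "\<lambda>(w, u). ((\<lambda>i. w (i + 1)), (\<lambda>i. u (i + 1)))"
  have pair: "P \<Otimes>\<^sub>M noise = distr (P \<Otimes>\<^sub>M noise) (P \<Otimes>\<^sub>M noise) ?sh"
    using pair_measure_distr[OF shP shN] noise.sigma_finite_measure_axioms
    unfolding distr_shift_noise PP by simp
  have shm: "?sh \<in> P \<Otimes>\<^sub>M noise \<rightarrow>\<^sub>M P \<Otimes>\<^sub>M noise"
    using shP shN by measurable
  have shQ: "(\<lambda>x i. x (i + 1)) \<in> seq_space AL \<rightarrow>\<^sub>M seq_space AL"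
    unfolding seq_space_def by (intro measurable_abs_UNIV measurable_component_singleton) simp
  have "distr Q (seq_space AL) (\<lambda>x i. x (i + 1)) =
      distr (P \<Otimes>\<^sub>M noise) (seq_space AL) ((\<lambda>x i. x (i + 1)) \<circ> couple)"
    unfolding Q_def by (rule distr_distr[OF shQ couple_measurable])
  also have "(\<lambda>x i. x (i + 1)) \<circ> couple = couple \<circ> ?sh"
    by (auto simp: fun_eq_iff couple_def view_shift)
  also have "distr (P \<Otimes>\<^sub>M noise) (seq_space AL) (couple \<circ> ?sh) =
      distr (distr (P \<Otimes>\<^sub>M noise) (P \<Otimes>\<^sub>M noise) ?sh) (seq_space AL) couple"
    by (rule distr_distr[OF couple_measurable shm, symmetric])
  also have "\<dots> = Q"
    unfolding pair[symmetric] Q_def ..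
  finally show "distr Q (seq_space AL) (\<lambda>x i. x (i + 1)) = Q" .
qed

lemma distr_fst_Q: "distr Q (seq_space A) (\<lambda>x i. fst (x i)) = P"
proof -
  have "distr Q (seq_space A) (\<lambda>x i. fst (x i)) =
      distr (P \<Otimes>\<^sub>M noise) (seq_space A) ((\<lambda>x i. fst (x i)) \<circ> couple)"
    unfolding Q_def
  proof (rule distr_distr[OF _ couple_measurable])
    show "(\<lambda>x i. fst (x i)) \<in> seq_space AL \<rightarrow>\<^sub>M seq_space A"
      using fst_Q by (simp add: seq_space_def measurable_cong_sets[OF sets_Q refl])
  qed
  also have "(\<lambda>x i. fst (x i)) \<circ> couple = fst"
    by (auto simp: fun_eq_iff couple_def)
  also have "distr (P \<Otimes>\<^sub>M noise) (seq_space A) fst = distr (P \<Otimes>\<^sub>M noise) P fst"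
    by (intro distr_cong) (simp_all add: sets_P seq_space_def)
  also have "\<dots> = P"
    by (rule noise.distr_pair_fst)
  finally show ?thesis .
qed

section \<open>The law of the step sequence\<close>

definition R :: "(int \<Rightarrow> nat) measure" where
  "R = distr Q (seq_space pos_nat_space) (\<lambda>x i. snd (x i))"

lemma snd_seq: "(\<lambda>x i. snd (x i)) \<in> Q \<rightarrow>\<^sub>M seq_space pos_nat_space"
  unfolding seq_space_def by (intro measurable_abs_UNIV snd_Q)

lemma stationary_R: "stationary_process pos_nat_space R"
  unfolding stationary_process_def
proof (intro conjI)
  show "prob_space R" unfolding R_def by (rule Q.prob_space_distr[OF snd_seq])
  show "sets R = sets (seq_space pos_nat_space)" by (simp add: R_def)
  have sh: "(\<lambda>x i. x (i + 1)) \<in> seq_space M \<rightarrow>\<^sub>M seq_space M" for M :: "'x measure"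
    unfolding seq_space_def by (intro measurable_abs_UNIV measurable_component_singleton) simp
  have QQ: "distr Q (seq_space AL) (\<lambda>x i. x (i + 1)) = Q"
    using stationary_Q by (simp add: stationary_process_def)
  have shQ: "(\<lambda>x i. x (i + 1)) \<in> Q \<rightarrow>\<^sub>M seq_space AL"
    using sh by (simp add: measurable_cong_sets[OF sets_Q refl] seq_space_def)
  have sndL: "(\<lambda>x i. snd (x i)) \<in> seq_space AL \<rightarrow>\<^sub>M seq_space pos_nat_space"
    using snd_seq by (simp add: measurable_cong_sets[OF sets_Q refl] seq_space_def)
  have "distr R (seq_space pos_nat_space) (\<lambda>l i. l (i + 1)) =
      distr Q (seq_space pos_nat_space) ((\<lambda>l i. l (i + 1)) \<circ> (\<lambda>x i. snd (x i)))"
    unfolding R_def by (rule distr_distr[OF sh snd_seq])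
  also have "(\<lambda>l i. l (i + 1)) \<circ> (\<lambda>x i. snd (x i)) = (\<lambda>x i. snd (x i)) \<circ> (\<lambda>(x :: int \<Rightarrow> 'a \<times> nat) i. x (i + 1))"
    by (auto simp: fun_eq_iff)
  also have "distr Q (seq_space pos_nat_space) \<dots> =
      distr (distr Q (seq_space AL) (\<lambda>x i. x (i + 1))) (seq_space pos_nat_space) (\<lambda>x i. snd (x i))"
    by (rule distr_distr[OF sndL shQ, symmetric])
  also have "\<dots> = R" unfolding QQ R_def ..
  finally show "distr R (seq_space pos_nat_space) (\<lambda>l i. l (i + 1)) = R" .
qed

lemma emeasure_R_cylinder:
  assumes "finite J" "\<And>j. j \<in> J \<Longrightarrow> F j \<in> sets pos_nat_space"
  shows "emeasure R (prod_emb UNIV (\<lambda>_. pos_nat_space) J (Pi\<^sub>E J F)) = (\<Prod>j\<in>J. law (F j))"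
proof -
  let ?C = "prod_emb UNIV (\<lambda>_. pos_nat_space) J (Pi\<^sub>E J F)"
  have C: "?C \<in> sets (seq_space pos_nat_space)"
    unfolding seq_space_def using assms by (intro sets_PiM_I) auto
  have "emeasure R ?C = (\<integral>\<^sup>+x. indicator ?C (\<lambda>i. snd (x i)) \<partial>Q)"
    unfolding R_def using C snd_seq
    by (subst nn_integral_indicator[symmetric], simp, subst nn_integral_distr) auto
  also have "\<dots> = (\<integral>\<^sup>+x. 1 * (\<Prod>j\<in>J. indicator (F j) (snd (x j))) \<partial>Q)"
  proof (intro nn_integral_cong)
    fix x assume "x \<in> space Q"
    then have "snd (x i) \<in> space pos_nat_space" for i by (rule measurable_space[OF snd_Q])
    then show "indicator ?C (\<lambda>i. snd (x i)) = (1 * (\<Prod>j\<in>J. indicator (F j) (snd (x j))) :: ennreal)"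
      using assms(1) by (auto simp: prod_emb_def PiE_iff indicator_def space_PiM)
  qed
  also have "\<dots> = (\<Prod>j\<in>J. law (F j))"
    using nn_integral_Q[where J = J and F = F and \<phi> = "\<lambda>_. 1", OF assms] nn_integral_prod_step_prob[OF assms(1), of F] by simp
  finally show ?thesis .
qed

lemma sets_R: "sets R = sets (Pi\<^sub>M UNIV (\<lambda>_. pos_nat_space))"
  by (simp add: R_def seq_space_def)

lemma component_R: "(\<lambda>l. l i) \<in> R \<rightarrow>\<^sub>M pos_nat_space"
  unfolding measurable_cong_sets[OF sets_R refl] by (intro measurable_component_singleton) simp

text \<open>Both measures give a cylinder the product of the values \<open>law (F j)\<close>: for
  \<open>R\<close> by the joint step probabilities, for the product measure by the one-coordinate
  case. Cylinders determine a finite measure on the infinite product.\<close>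

lemma R_eq_PiM: "R = Pi\<^sub>M UNIV (\<lambda>i. distr R pos_nat_space (\<lambda>l. l i))"
proof (rule measure_eqI_PiM_infinite[where M = "\<lambda>_. pos_nat_space"])
  interpret R: prob_space R using stationary_R by (simp add: stationary_process_def)
  have pc: "prob_space (distr R pos_nat_space (\<lambda>l. l i))" for i
    by (rule R.prob_space_distr[OF component_R])
  show "sets R = sets (Pi\<^sub>M UNIV (\<lambda>_. pos_nat_space))" by (rule sets_R)
  show "sets (Pi\<^sub>M UNIV (\<lambda>i. distr R pos_nat_space (\<lambda>l. l i))) = sets (Pi\<^sub>M UNIV (\<lambda>_. pos_nat_space))"
    by (intro sets_PiM_cong) auto
  show "finite_measure R" by (rule R.finite_measure_axioms)
  fix F and J :: "int set" assume J: "finite J" and F: "\<And>j. j \<in> J \<Longrightarrow> F j \<in> sets pos_nat_space"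
  have comp: "emeasure (distr R pos_nat_space (\<lambda>l. l j)) (F j) = law (F j)" if "j \<in> J" for j
  proof -
    have "emeasure (distr R pos_nat_space (\<lambda>l. l j)) (F j) = emeasure R ((\<lambda>l. l j) -` F j \<inter> space R)"
      by (rule emeasure_distr[OF component_R F[OF that]])
    also have "(\<lambda>l. l j) -` F j \<inter> space R = prod_emb UNIV (\<lambda>_. pos_nat_space) {j} (Pi\<^sub>E {j} F)"
      using sets_eq_imp_space_eq[OF sets_R] by (auto simp: prod_emb_def space_PiM PiE_iff)
    finally show ?thesis using emeasure_R_cylinder[of "{j}" F] F[OF that] by simp
  qed
  have "emeasure (Pi\<^sub>M UNIV (\<lambda>i. distr R pos_nat_space (\<lambda>l. l i)))
      (prod_emb UNIV (\<lambda>i. distr R pos_nat_space (\<lambda>l. l i)) J (Pi\<^sub>E J F)) =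
      (\<Prod>j\<in>J. emeasure (distr R pos_nat_space (\<lambda>l. l j)) (F j))"
    using J F by (intro emeasure_PiM_emb pc) auto
  also have "prod_emb UNIV (\<lambda>i. distr R pos_nat_space (\<lambda>l. l i)) J (Pi\<^sub>E J F) =
      prod_emb UNIV (\<lambda>_. pos_nat_space) J (Pi\<^sub>E J F)"
    by (simp add: prod_emb_def)
  finally show "emeasure R (prod_emb UNIV (\<lambda>_. pos_nat_space) J (Pi\<^sub>E J F)) =
      emeasure (Pi\<^sub>M UNIV (\<lambda>i. distr R pos_nat_space (\<lambda>l. l i))) (prod_emb UNIV (\<lambda>_. pos_nat_space) J (Pi\<^sub>E J F))"
    using emeasure_R_cylinder[OF J F] comp by simp
qed

lemma indep_R: "prob_space.indep_vars R (\<lambda>_. pos_nat_space) (\<lambda>i l. l i) UNIV"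
proof -
  interpret R: prob_space R using stationary_R by (simp add: stationary_process_def)
  have "distr R (Pi\<^sub>M UNIV (\<lambda>_. pos_nat_space)) (\<lambda>x. \<lambda>i\<in>UNIV. x i) = R"
    by (simp add: distr_id2 sets_R restrict_UNIV)
  then show ?thesis
    using R_eq_PiM by (subst R.indep_vars_iff_distr_eq_PiM) (auto intro: component_R)
qed

section \<open>Independence of the past, and the conditional laws given the step\<close>

lemma past_Q[measurable]: "(\<lambda>x. \<lambda>i\<in>I. fst (x i)) \<in> Q \<rightarrow>\<^sub>M Pi\<^sub>M I (\<lambda>_. A)"
  by (intro measurable_restrict fst_component_Q)

text \<open>Both generated algebras consist of preimages, so only the probability of
  \<open>a \<inter> b\<close> has to factorise, and \<open>nn_integral_Q_past\<close> computes it as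
  a function of \<open>F\<close> times a function of \<open>C\<close>.\<close>

lemma indep_Q:
  "prob_space.indep_set Q
     (sets (vimage_algebra (space Q) (\<lambda>x. snd (x 0)) pos_nat_space))
     (sets (vimage_algebra (space Q) (\<lambda>x. \<lambda>i\<in>past. fst (x i)) B))"
proof (rule Q.indep_setI)
  have L: "sets (vimage_algebra (space Q) (\<lambda>x. snd (x 0)) pos_nat_space) =
      {(\<lambda>x. snd (x 0)) -` F \<inter> space Q | F. F \<in> sets pos_nat_space}"
    using measurable_space[OF snd_Q[of 0]] by (intro sets_vimage_algebra2) auto
  have X: "sets (vimage_algebra (space Q) (\<lambda>x. \<lambda>i\<in>past. fst (x i)) B) =
      {(\<lambda>x. \<lambda>i\<in>past. fst (x i)) -` C \<inter> space Q | C. C \<in> sets B}"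
    using measurable_space[OF past_Q[of past]] by (intro sets_vimage_algebra2) auto
  show "sets (vimage_algebra (space Q) (\<lambda>x. snd (x 0)) pos_nat_space) \<subseteq> Q.events"
    unfolding L using measurable_sets[OF snd_Q] by blast
  show "sets (vimage_algebra (space Q) (\<lambda>x. \<lambda>i\<in>past. fst (x i)) B) \<subseteq> Q.events"
    unfolding X using measurable_sets[OF past_Q] by blast
  fix a b assume "a \<in> sets (vimage_algebra (space Q) (\<lambda>x. snd (x 0)) pos_nat_space)"
    and "b \<in> sets (vimage_algebra (space Q) (\<lambda>x. \<lambda>i\<in>past. fst (x i)) B)"
  then obtain F C where F: "F \<in> sets pos_nat_space" and C: "C \<in> sets B"
    and a: "a = (\<lambda>x. snd (x 0)) -` F \<inter> space Q" and b: "b = (\<lambda>x. \<lambda>i\<in>past. fst (x i)) -` C \<inter> space Q"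
    unfolding L X by blast
  have ab: "a \<in> Q.events" "b \<in> Q.events"
    unfolding a b using measurable_sets[OF snd_Q F] measurable_sets[OF past_Q C] by blast+
  define c where "c = (\<integral>\<^sup>+w. indicator C (restrict w past) \<partial>P :: ennreal)"
  have full: "{1..} \<in> sets pos_nat_space" by (simp add: pos_nat_space_def)
  have one: "Suc 0 \<le> snd (x 0)" if "x \<in> space Q" for x
    using measurable_space[OF snd_Q that, of 0] by (simp add: pos_nat_space_def)
  have em: "emeasure Q S = (\<integral>\<^sup>+x. f x \<partial>Q)"
    if "S \<in> Q.events" "\<And>x. x \<in> space Q \<Longrightarrow> indicator S x = f x" for S and f :: "_ \<Rightarrow> ennreal"
    using nn_integral_indicator[OF that(1)] nn_integral_cong[of Q "indicator S" f] that(2) by simp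
  have "emeasure Q (a \<inter> b) = (\<integral>\<^sup>+x. indicator C (\<lambda>i\<in>past. fst (x i)) * indicator F (snd (x 0)) \<partial>Q)"
    by (rule em) (use ab in \<open>auto simp: a b indicator_def\<close>)
  also have "\<dots> = law F * c"
    unfolding c_def using C by (intro nn_integral_Q_past F) auto
  finally have 1: "emeasure Q (a \<inter> b) = law F * c" .
  have "emeasure Q a = (\<integral>\<^sup>+x. 1 * indicator F (snd (x 0)) \<partial>Q)"
    by (rule em) (use ab in \<open>auto simp: a indicator_def\<close>)
  also have "\<dots> = law F * (\<integral>\<^sup>+w. 1 \<partial>P)"
    by (rule nn_integral_Q_past[OF F]) simp
  finally have 2: "emeasure Q a = law F" by (simp add: P.emeasure_space_1)
  \<comment> \<open>An event of the past alone is the case of an unconstrained step;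
    \<open>law_space\<close> removes the extra factor.\<close>
  have "emeasure Q b = (\<integral>\<^sup>+x. indicator C (\<lambda>i\<in>past. fst (x i)) * indicator {1..} (snd (x 0)) \<partial>Q)"
    by (rule em) (use ab in \<open>auto simp: b indicator_def intro: one\<close>)
  also have "\<dots> = law {1..} * c"
    unfolding c_def using C by (intro nn_integral_Q_past full) auto
  finally have 3: "emeasure Q b = c" by (simp only: law_space mult_1)
  show "Q.prob (a \<inter> b) = Q.prob a * Q.prob b"
    using 1 unfolding 2[symmetric] 3[symmetric] by (simp add: measure_def enn2real_mult)
qed

text \<open>Conditioning on a step \<open>n = m k\<close> weights the law of \<open>X_0\<close>
  given the past by \<open>g k\<close>, which turns it into \<open>\<mu> k\<close>. So
  \<open>\<mu> k\<close> serves for the finite past and its pullback for the infinite past, and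
  these two versions agree at every point.\<close>

lemma random_step_conditional:
  assumes n: "0 < n" and pos: "measure Q {x \<in> space Q. snd (x 0) = n} > 0"
  defines "Qn \<equiv> uniform_measure Q {x \<in> space Q. snd (x 0) = n}"
  obtains \<kappa>n \<kappa> where
    "regular_cond_dist Qn A (\<lambda>x. fst (x 0))
      (Pi\<^sub>M (past_upto n) (\<lambda>_. A)) (\<lambda>x. \<lambda>i\<in>past_upto n. fst (x i)) \<kappa>n"
    "regular_cond_dist Qn A (\<lambda>x. fst (x 0))
      (Pi\<^sub>M past (\<lambda>_. A)) (\<lambda>x. \<lambda>i\<in>past. fst (x i)) \<kappa>"
    "AE x in Qn. \<forall>E\<in>sets A.
      measure (\<kappa>n (\<lambda>i\<in>past_upto n. fst (x i))) E = measure (\<kappa> (\<lambda>i\<in>past. fst (x i))) E"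
proof -
  let ?S = "{x \<in> space Q. snd (x 0) = n}"
  have F: "{n} \<in> sets pos_nat_space" using n by (simp add: pos_nat_space_def)
  have S: "?S \<in> sets Q"
    using measurable_sets[OF snd_Q F, of 0] by (simp add: vimage_def Int_def conj_commute)
  have iS: "indicator ?S x = (indicator {n} (snd (x 0)) :: ennreal)" if "x \<in> space Q" for x
    using that by (simp add: indicator_def)
  have posS: "emeasure Q ?S > 0" "emeasure Q ?S < top"
    using pos by (auto simp: Q.emeasure_eq_measure)
  interpret Qn: prob_space Qn
    unfolding Qn_def using posS by (intro prob_space_uniform_measure) auto
  have "emeasure Q ?S = (\<integral>\<^sup>+x. indicator ?S x \<partial>Q)"
    using S by simp
  also have "\<dots> = (\<integral>\<^sup>+x. 1 * indicator {n} (snd (x 0)) \<partial>Q)"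
    by (intro nn_integral_cong) (simp only: iS mult_1)
  also have "\<dots> = law {n}"
    by (subst nn_integral_Q_past[OF F]) (simp_all add: P.emeasure_space_1)
  finally have "law {n} \<noteq> 0" using posS by auto
  \<comment> \<open>All the mass of \<open>law\<close> sits on the values of \<open>m\<close>, so
    positive probability forces \<open>n\<close> to be one of them.\<close>
  obtain k where k: "n = m k"
  proof (rule ccontr)
    assume "\<not> thesis"
    with that have "indicator {n} (m k) = (0 :: ennreal)" for k by (auto simp: indicator_def)
    with \<open>law {n} \<noteq> 0\<close> show False by (simp add: law_def)
  qed
  have ind: "indicator {n} (m j) = (if j = k then 1 else 0 :: ennreal)" for j
    using m(1) by (auto simp: k strict_mono_eq)
  have single: "(\<Sum>j. indicator {n} (m j) * f j) = f k" for f :: "nat \<Rightarrow> ennreal"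
    unfolding ind using suminf_finite[of "{k}" "\<lambda>j. (if j = k then 1 else 0) * f j"] by simp
  have law_n: "law {n} = ennreal (p k)" unfolding law_def by (rule single)
  have AE_n: "AE w in P. step_prob {n} (view 0 w) = g k (restrict w past, w 0)"
    using AE_step_prob by eventually_elim (simp only: single view_0)
  define \<kappa> where "\<kappa> y = \<mu> k (restrict y (past_upto n))" for y
  have mp: "past_upto n \<subseteq> past" by auto
  have \<mu>k: "\<mu> k \<in> Pi\<^sub>M (past_upto n) (\<lambda>_. A) \<rightarrow>\<^sub>M prob_algebra A"
    unfolding k by (rule \<mu>)
  have \<kappa>: "\<kappa> \<in> B \<rightarrow>\<^sub>M prob_algebra A"
    unfolding \<kappa>_def by (rule measurable_compose[OF measurable_restrict_subset[OF mp] \<mu>k])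
  note [measurable] = measurable_prob_algebraD[OF \<kappa>]
  have \<kappa>r: "\<kappa> (\<lambda>i\<in>past. f i) = \<mu> k (\<lambda>i\<in>past_upto n. f i)" for f :: "int \<Rightarrow> 'a"
    unfolding \<kappa>_def by (simp only: restrict_restrict Int_absorb1[OF mp])
  have setsQn: "sets Qn = sets Q" by (simp add: Qn_def)
  have key: "(\<integral>\<^sup>+x. indicator C (\<lambda>i\<in>past. fst (x i)) * indicator E (fst (x 0)) \<partial>Qn) =
      (\<integral>\<^sup>+x. indicator C (\<lambda>i\<in>past. fst (x i)) * emeasure (\<kappa> (\<lambda>i\<in>past. fst (x i))) E \<partial>Qn)"
    if C[measurable]: "C \<in> sets B" and E[measurable]: "E \<in> sets A" for C E
  proof -
    have "(\<lambda>w. w 0) \<in> P \<rightarrow>\<^sub>M A" by measurable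
    then have E0: "(\<lambda>w. indicator E (w 0) :: ennreal) \<in> borel_measurable P"
      by (rule measurable_compose[OF _ borel_measurable_indicator[OF E]])
    have l: "(\<lambda>x. indicator C (\<lambda>i\<in>past. fst (x i)) * indicator E (fst (x 0)) :: ennreal) \<in> borel_measurable Q"
      by (intro borel_measurable_times_ennreal measurable_compose[OF past_Q borel_measurable_indicator[OF C]]
          measurable_compose[OF fst_component_Q borel_measurable_indicator[OF E]])
    have \<phi>: "(\<lambda>y. indicator C y * emeasure (\<kappa> y) E) \<in> borel_measurable B" by measurable
    have r: "(\<lambda>x. indicator C (\<lambda>i\<in>past. fst (x i)) * emeasure (\<kappa> (\<lambda>i\<in>past. fst (x i))) E) \<in> borel_measurable Q"
      by (rule measurable_compose[OF past_Q \<phi>])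
    have "(\<integral>\<^sup>+x. indicator C (\<lambda>i\<in>past. fst (x i)) * indicator E (fst (x 0)) * indicator ?S x \<partial>Q) =
        (\<integral>\<^sup>+x. indicator C (restrict (\<lambda>i. fst (x i)) past) * indicator E (fst (x 0)) * indicator {n} (snd (x 0)) \<partial>Q)"
      by (intro nn_integral_cong) (simp add: iS)
    also have "\<dots> = (\<integral>\<^sup>+w. indicator C (restrict w past) * indicator E (w 0) * step_prob {n} (view 0 w) \<partial>P)"
      using E0 by (intro nn_integral_Q_0[OF F, of "\<lambda>w. indicator C (restrict w past) * indicator E (w 0)"]) measurable
    also have "\<dots> = (\<integral>\<^sup>+w. indicator C (restrict w past) * indicator E (w 0) * g k (restrict w past, w 0) \<partial>P)"
      using AE_n by (intro nn_integral_cong_AE) (auto elim: eventually_mono)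
    also have "\<dots> = ennreal (p k) * (\<integral>\<^sup>+w. indicator C (restrict w past) * emeasure (\<kappa> (restrict w past)) E \<partial>P)"
      using g_cond[of "indicator C" E k] by (simp add: \<kappa>r k[symmetric])
    \<comment> \<open>Here \<open>nn_integral_Q_past\<close> is read from right to left:
      \<open>p k = law {n}\<close> turns back into the event that the step is
      \<open>n\<close>.\<close>
    also have "\<dots> = (\<integral>\<^sup>+x. indicator C (\<lambda>i\<in>past. fst (x i)) * emeasure (\<kappa> (\<lambda>i\<in>past. fst (x i))) E * indicator {n} (snd (x 0)) \<partial>Q)"
      using nn_integral_Q_past[OF F \<phi>] by (simp add: law_n)
    also have "\<dots> = (\<integral>\<^sup>+x. indicator C (\<lambda>i\<in>past. fst (x i)) * emeasure (\<kappa> (\<lambda>i\<in>past. fst (x i))) E * indicator ?S x \<partial>Q)"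
      by (intro nn_integral_cong) (simp add: iS)
    finally show ?thesis
      unfolding Qn_def nn_integral_uniform_measure[OF l S] nn_integral_uniform_measure[OF r S] by simp
  qed
  have m: "(\<lambda>x. \<lambda>i\<in>I. fst (x i)) \<in> Qn \<rightarrow>\<^sub>M Pi\<^sub>M I (\<lambda>_. A)" "(\<lambda>x. fst (x 0)) \<in> Qn \<rightarrow>\<^sub>M A" for I
    unfolding measurable_cong_sets[OF setsQn refl] by (rule past_Q fst_component_Q)+
  show thesis
  proof (rule that)
    show "regular_cond_dist Qn A (\<lambda>x. fst (x 0)) B (\<lambda>x. \<lambda>i\<in>past. fst (x i)) \<kappa>"
      by (rule regular_cond_distI[OF Qn.prob_space_axioms m \<kappa> key])
    show "regular_cond_dist Qn A (\<lambda>x. fst (x 0))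
      (Pi\<^sub>M (past_upto n) (\<lambda>_. A)) (\<lambda>x. \<lambda>i\<in>past_upto n. fst (x i)) (\<mu> k)"
    proof (rule regular_cond_distI[OF Qn.prob_space_axioms m \<mu>k])
      fix C E assume C: "C \<in> sets (Pi\<^sub>M (past_upto n) (\<lambda>_. A))" and E: "E \<in> sets A"
      \<comment> \<open>An event of the finite past, pulled back to the infinite past, falls under
        \<open>key\<close>.\<close>
      let ?C = "(\<lambda>y. restrict y (past_upto n)) -` C \<inter> space B"
      have C': "?C \<in> sets B"
        by (rule measurable_sets[OF measurable_restrict_subset[OF mp] C])
      have "indicator ?C (\<lambda>i\<in>past. fst (x i)) = (indicator C (\<lambda>i\<in>past_upto n. fst (x i)) :: ennreal)"
        if "x \<in> space Qn" for x
        using measurable_space[OF m(1) that, of past]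
        by (simp only: indicator_def Int_iff vimage_eq restrict_restrict Int_absorb1[OF mp] simp_thms)
      with key[OF C' E] show "(\<integral>\<^sup>+x. indicator C (\<lambda>i\<in>past_upto n. fst (x i)) * indicator E (fst (x 0)) \<partial>Qn) =
          (\<integral>\<^sup>+x. indicator C (\<lambda>i\<in>past_upto n. fst (x i)) * emeasure (\<mu> k (\<lambda>i\<in>past_upto n. fst (x i))) E \<partial>Qn)"
        by (simp only: \<kappa>r cong: nn_integral_cong)
    qed
  qed (intro AE_I2 ballI, simp only: \<kappa>r)
qed

end

theorem theorem3:
  fixes A :: "'a measure" and P :: "(int \<Rightarrow> 'a) measure"
  assumes "stationary_process A P"
    and "berbee_ratio_condition A P"
  shows "random_step_markov A P"
proof -
  obtain m p \<mu> g where "random_step_data A P m p \<mu> g"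
    using random_step_data_exists[OF assms] by blast
  then interpret random_step_data A P m p \<mu> g .
  show ?thesis
    unfolding random_step_markov_def
  proof (intro conjI exI[of _ R] exI[of _ Q] allI impI)
    fix n :: nat assume "n > 0" "measure Q {w \<in> space Q. snd (w 0) = n} > 0"
    from random_step_conditional[OF this]
    show "let Qn = uniform_measure Q {w \<in> space Q. snd (w 0) = n} in
            \<exists>\<kappa>n \<kappa>.
              regular_cond_dist Qn A (\<lambda>w. fst (w 0))
                (Pi\<^sub>M (past_upto n) (\<lambda>_. A)) (\<lambda>w. \<lambda>i\<in>past_upto n. fst (w i)) \<kappa>n \<and>
              regular_cond_dist Qn A (\<lambda>w. fst (w 0))
                (Pi\<^sub>M past (\<lambda>_. A)) (\<lambda>w. \<lambda>i\<in>past. fst (w i)) \<kappa> \<and>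
              (AE w in Qn. \<forall>E\<in>sets A.
                 measure (\<kappa>n (\<lambda>i\<in>past_upto n. fst (w i))) E =
                 measure (\<kappa> (\<lambda>i\<in>past. fst (w i))) E)"
      unfolding Let_def by blast
  qed (simp_all add: assms stationary_R indep_R stationary_Q distr_fst_Q indep_Q R_def[symmetric])
qed

end
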